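(* Let $\langle X,\mathcal{M},\mathbf{O}\rangle$ be a measurement scenario with $X$ finite and with each outcome space $\mathbf{O}_x$ ($x\in X$) the Borel measurable space of a compact Hausdorff space $O_x$. Let $e=(e_C)_{C\in\mathcal{M}}$ be an empirical model on it. Consider the infinite linear programs (P-CF): maximise $\mu(O_X)$ over finite signed measures $\mu$ on $\mathbf{O}_X$ subject to $\mu|_C\le e_C$ for all $C\in\mathcal{M}$ and $\mu\ge 0$; (D-CF): minimise $\sum_{C\in\mathcal{M}}\int_{O_C}f_C\,de_C$ over families $(f_C)_{C\in\mathcal{M}}\in\prod_{C\in\mathcal{M}}C(O_C,\mathbb{R})$ subject to $\sum_{C\in\mathcal{M}}f_C\circ\rho^X_C\ge \mathbf{1}$ pointwise on $O_X$ and $f_C\ge 0$ pointwise on $O_C$ for all $C\in\mathcal{M}$. Then (P-CF) and (D-CF) have zero duality gap, and their optimal values (supremum and infimum respectively) satisfy $$\mathrm{val}(\text{P-CF})=\mathrm{val}(\text{D-CF})=\mathsf{NCF}(e).$$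
   Context: A measurement scenario $\langle X,\mathcal{M},\mathbf{O}\rangle$ consists of: a set $X$ of measurement labels; a family $\mathcal{M}$ of subsets of $X$ with $\bigcup\mathcal{M}=X$ that is an anti-chain for inclusion (its elements are called maximal contexts); and, for each $x\in X$, a measurable space $\mathbf{O}_x=\langle O_x,\mathcal{F}_x\rangle$. For $U\subseteq X$, $\mathbf{O}_U=\prod_{x\in U}\mathbf{O}_x$ is the product measurable space, with underlying set $O_U=\prod_{x\in U}O_x$ (given the product topology). For $C\in\mathcal{M}$, $\rho^X_C:O_X\to O_C$ is the projection. For $U\subseteq V$ and a (signed) measure $\mu$ on $\mathbf{O}_V$, $\mu|_U$ denotes the marginal, i.e. the push-forward along the projection $O_V\to O_U$. Inequalities between measures are setwise. An empirical model $e$ on the scenario is a family $(e_C)_{C\in\mathcal{M}}$ with $e_C$ a probability measure on $\mathbf{O}_C$, such that $e_C|_{C\cap C'}=e_{C'}|_{C\cap C'}$ for all $C,C'\in\mathcal{M}$. The noncontextual fraction of $e$ is $\mathsf{NCF}(e)=\sup\{\mu(O_X):\mu\text{ a (nonnegative) measure on }\mathbf{O}_X,\ \mu|_C\le e_C\ \text{for all } C\in\mathcal{M}\}$. $C(O_C,\mathbb{R})$ is the space of continuous real-valued functions on $O_C$; $\mathbf{1}$ is the constant function $1$.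
   Formalization: Each probability measure e_C is additionally assumed inner regular with respect to compact measurable sets; for non-regular Borel measures (e.g. a PR box built from the Dieudonné measure on [0,ω₁]) the claimed equality fails. *)

theory Defs
  imports "HOL-Probability.Probability"
begin

text \<open>
  Measurement labels have type \<open>'x\<close>, and all outcomes live in one type \<open>'a\<close>. Outcome spaces are
  \<open>'a measure\<close> values, used only for their carrier and \<open>\<sigma>\<close>-algebra, or \<open>'a topology\<close> values; both
  may vary with the label. Joint outcomes over \<open>U\<close> are the extensional functions on \<open>U\<close>, and the
  projection to \<open>U\<close> is \<open>\<lambda>\<omega>. restrict \<omega> U\<close>.
\<close>

definition measurement_scenario :: "'x set \<Rightarrow> 'x set set \<Rightarrow> bool" where
  "measurement_scenario X M \<longleftrightarrow> \<Union>M = X \<and> (\<forall>C\<in>M. \<forall>C'\<in>M. C \<subseteq> C' \<longrightarrow> C = C')"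

definition marginal ::
  "('x \<Rightarrow> 'a measure) \<Rightarrow> 'x set \<Rightarrow> ('x \<Rightarrow> 'a) measure \<Rightarrow> ('x \<Rightarrow> 'a) measure" where
  "marginal Out U \<mu> = distr \<mu> (PiM U Out) (\<lambda>\<omega>. restrict \<omega> U)"

definition empirical_model ::
  "('x \<Rightarrow> 'a measure) \<Rightarrow> 'x set set \<Rightarrow> ('x set \<Rightarrow> ('x \<Rightarrow> 'a) measure) \<Rightarrow> bool" where
  "empirical_model Out M e \<longleftrightarrow>
     (\<forall>C\<in>M. prob_space (e C) \<and> sets (e C) = sets (PiM C Out)) \<and>
     (\<forall>C\<in>M. \<forall>C'\<in>M. marginal Out (C \<inter> C') (e C) = marginal Out (C \<inter> C') (e C'))"

definition NCF ::
  "('x \<Rightarrow> 'a measure) \<Rightarrow> 'x set \<Rightarrow> 'x set set \<Rightarrow> ('x set \<Rightarrow> ('x \<Rightarrow> 'a) measure) \<Rightarrow> ennreal" where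
  "NCF Out X M e =
     (SUP \<mu> \<in> {\<mu>. sets \<mu> = sets (PiM X Out) \<and>
                 (\<forall>C\<in>M. \<forall>A\<in>sets (PiM C Out). emeasure (marginal Out C \<mu>) A \<le> emeasure (e C) A)}.
        emeasure \<mu> (space \<mu>))"

text \<open>
  A finite signed measure on \<open>N\<close> is a real-valued countably additive set function; its values
  outside \<open>sets N\<close> are irrelevant.
\<close>

definition finite_signed_measure :: "'b measure \<Rightarrow> ('b set \<Rightarrow> real) \<Rightarrow> bool" where
  "finite_signed_measure N \<nu> \<longleftrightarrow>
     \<nu> {} = 0 \<and>
     (\<forall>A :: nat \<Rightarrow> 'b set. range A \<subseteq> sets N \<longrightarrow> disjoint_family A \<longrightarrow>
        (\<lambda>i. \<nu> (A i)) sums \<nu> (\<Union>i. A i))"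

definition signed_marginal ::
  "('x \<Rightarrow> 'a measure) \<Rightarrow> 'x set \<Rightarrow> 'x set \<Rightarrow> (('x \<Rightarrow> 'a) set \<Rightarrow> real) \<Rightarrow> ('x \<Rightarrow> 'a) set \<Rightarrow> real" where
  "signed_marginal Out V U \<nu> A = \<nu> ((\<lambda>\<omega>. restrict \<omega> U) -` A \<inter> space (PiM V Out))"

definition primal_feasible ::
  "('x \<Rightarrow> 'a measure) \<Rightarrow> 'x set \<Rightarrow> 'x set set \<Rightarrow> ('x set \<Rightarrow> ('x \<Rightarrow> 'a) measure)
     \<Rightarrow> (('x \<Rightarrow> 'a) set \<Rightarrow> real) \<Rightarrow> bool" where
  "primal_feasible Out X M e \<nu> \<longleftrightarrow>
     finite_signed_measure (PiM X Out) \<nu> \<and>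
     (\<forall>C\<in>M. \<forall>A\<in>sets (PiM C Out). signed_marginal Out X C \<nu> A \<le> measure (e C) A) \<and>
     (\<forall>A\<in>sets (PiM X Out). 0 \<le> \<nu> A)"

definition primal_value ::
  "('x \<Rightarrow> 'a measure) \<Rightarrow> 'x set \<Rightarrow> 'x set set \<Rightarrow> ('x set \<Rightarrow> ('x \<Rightarrow> 'a) measure) \<Rightarrow> ereal" where
  "primal_value Out X M e =
     (SUP \<nu> \<in> {\<nu>. primal_feasible Out X M e \<nu>}. ereal (\<nu> (space (PiM X Out))))"

definition dual_feasible ::
  "('x \<Rightarrow> 'a topology) \<Rightarrow> 'x set \<Rightarrow> 'x set set \<Rightarrow> ('x set \<Rightarrow> ('x \<Rightarrow> 'a) \<Rightarrow> real) \<Rightarrow> bool" where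
  "dual_feasible T X M f \<longleftrightarrow>
     (\<forall>C\<in>M. continuous_map (product_topology T C) euclideanreal (f C)) \<and>
     (\<forall>\<omega>\<in>topspace (product_topology T X). 1 \<le> (\<Sum>C\<in>M. f C (restrict \<omega> C))) \<and>
     (\<forall>C\<in>M. \<forall>\<omega>\<in>topspace (product_topology T C). 0 \<le> f C \<omega>)"

definition dual_value ::
  "('x \<Rightarrow> 'a topology) \<Rightarrow> 'x set \<Rightarrow> 'x set set \<Rightarrow> ('x set \<Rightarrow> ('x \<Rightarrow> 'a) measure) \<Rightarrow> ereal" where
  "dual_value T X M e =
     (INF f \<in> {f. dual_feasible T X M f}. ereal (\<Sum>C\<in>M. \<integral>\<omega>. f C \<omega> \<partial>e C))"

definition borel_of :: "'a topology \<Rightarrow> 'a measure" where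
  "borel_of T = sigma (topspace T) {U. openin T U}"

text \<open>
  Inner regularity with respect to the compact measurable sets. Without it a Borel measure on a
  compact Hausdorff space need not be determined by its integrals of continuous functions: on the
  ordinal space \<open>[0, \<omega>\<^sub>1]\<close>, the Dieudonne measure and the point mass at \<open>\<omega>\<^sub>1\<close> have the same such
  integrals. For finite measures on a finite product of compact metrizable spaces it always holds.
\<close>

definition compact_inner_regular :: "'b topology \<Rightarrow> 'b measure \<Rightarrow> bool" where
  "compact_inner_regular S \<mu> \<longleftrightarrow>
     (\<forall>A\<in>sets \<mu>. emeasure \<mu> A =
        (SUP K \<in> {K. compactin S K \<and> K \<in> sets \<mu> \<and> K \<subseteq> A}. emeasure \<mu> K))"

end

theory Submission
  imports Defs
begin

text \<open>
  Weak duality is integration of a dual cover against a feasible measure. For the converse, relax the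
  dual to families of functions \<open>f\<^sub>C\<close> that are suprema of continuous nonnegative functions; these
  include the indicators of measurable open sets, and compactness shows that the relaxation does not
  change the infimum. The least cost of covering a bounded function \<open>g\<close> on \<open>O\<^sub>X\<close> is a sublinear
  functional, so by Hahn--Banach it dominates a linear \<open>L\<close> that agrees with it at \<open>1\<close>. Then
  \<open>c A = L (indicator A)\<close> is a finitely additive set function on all subsets of \<open>O\<^sub>X\<close> whose total
  mass is the dual value, and regularity of \<open>e\<^sub>C\<close> gives \<open>c (\<rho>\<^sub>C -` A) \<le> e\<^sub>C A\<close>. Regularity also
  sandwiches each cylinder between a closed and an open set whose difference has small \<open>c\<close>, so by
  compactness \<open>c\<close> is countably additive on an algebra containing all cylinders, and Caratheodory's
  theorem yields the optimal measure.
\<close>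

section \<open>Sublinear functionals\<close>

text \<open>The infimum of \<open>p (x + t *\<^sub>R v) - t * p v\<close> over the ray
  \<open>t \<ge> 0\<close> works: \<open>t = 0\<close> gives the third property and
  \<open>t = 1\<close> the fourth. At \<open>x = - v\<close> the latter reads
  \<open>q (- v) \<le> - p v\<close>, so \<open>q\<close> has become odd along
  \<open>v\<close>.\<close>

lemma sublinear_decrease:
  fixes p :: "'v::real_vector \<Rightarrow> real"
  assumes add: "\<And>x y. p (x + y) \<le> p x + p y"
    and scale: "\<And>c x. c > 0 \<Longrightarrow> p (c *\<^sub>R x) \<le> c * p x"
  obtains q where "\<And>x y. q (x + y) \<le> q x + q y"
    and "\<And>c x. c > 0 \<Longrightarrow> q (c *\<^sub>R x) \<le> c * q x"
    and "\<And>x. q x \<le> p x"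
    and "\<And>x. q x \<le> p (x + v) - p v"
proof -
  define q where "q x = (INF t\<in>{0..}. p (x + t *\<^sub>R v) - t * p v)" for x
  have p0: "0 \<le> p 0"
    using add[of 0 0] by simp
  have pt: "p (t *\<^sub>R v) \<le> t * p v" if "t \<ge> 0" for t
  proof (cases "t = 0")
    case True
    have "p 0 \<le> 0"
      using scale[of "1/2" 0] p0 by simp
    with True show ?thesis by simp
  qed (use that scale in auto)
  \<comment> \<open>Scaling is assumed only as an inequality; the converse comes from scaling back
    by \<open>1/t\<close>.\<close>
  have tp: "t * p v \<le> p (t *\<^sub>R v)" if "t \<ge> 0" for t
  proof (cases "t = 0")
    case False
    then have "p ((1/t) *\<^sub>R (t *\<^sub>R v)) \<le> (1/t) * p (t *\<^sub>R v)"
      using that by (intro scale) auto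
    then show ?thesis
      using False that by (simp add: field_simps)
  qed (use p0 in simp)
  \<comment> \<open>The vectors \<open>- x\<close> and \<open>x + t *\<^sub>R v\<close> add up to
    \<open>t *\<^sub>R v\<close>, so subadditivity gives a lower bound independent of
    \<open>t\<close>.\<close>
  have bdd: "bdd_below ((\<lambda>t. p (x + t *\<^sub>R v) - t * p v) ` {0..})" for x
  proof (rule bdd_belowI2)
    fix t :: real assume "t \<in> {0..}"
    then show "- p (- x) \<le> p (x + t *\<^sub>R v) - t * p v"
      using add[of "- x" "x + t *\<^sub>R v"] tp[of t] by simp
  qed
  have upper: "q x \<le> p (x + t *\<^sub>R v) - t * p v" if "t \<ge> 0" for x t
    unfolding q_def by (rule cINF_lower[OF bdd]) (use that in simp)
  have lower: "m \<le> q x" if "\<And>t. t \<ge> 0 \<Longrightarrow> m \<le> p (x + t *\<^sub>R v) - t * p v" for x m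
    unfolding q_def by (rule cINF_greatest) (use that in auto)
  have "q (x + y) \<le> q x + q y" for x y
  proof -
    have "q (x + y) - q y \<le> p (x + s *\<^sub>R v) - s * p v" if "s \<ge> 0" for s
    proof -
      \<comment> \<open>The two infima are taken one after the other; parameters \<open>s\<close>
        for \<open>x\<close> and \<open>t\<close> for \<open>y\<close> combine to
        \<open>s + t\<close> for \<open>x + y\<close>.\<close>
      have "q (x + y) - (p (x + s *\<^sub>R v) - s * p v) \<le> p (y + t *\<^sub>R v) - t * p v" if "t \<ge> 0" for t
        using upper[of "s + t" "x + y"] add[of "x + s *\<^sub>R v" "y + t *\<^sub>R v"] \<open>s \<ge> 0\<close> that
        by (simp add: algebra_simps)
      from lower[OF this] show ?thesis by simp
    qed
    from lower[OF this] show ?thesis by simp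
  qed
  moreover have "q (c *\<^sub>R x) \<le> c * q x" if "c > 0" for c x
  proof -
    have "q (c *\<^sub>R x) / c \<le> p (x + t *\<^sub>R v) - t * p v" if "t \<ge> 0" for t
      using upper[of "c * t" "c *\<^sub>R x"] scale[of c "x + t *\<^sub>R v"] \<open>c > 0\<close> that
      unfolding pos_divide_le_eq[OF \<open>c > 0\<close>] by (simp add: algebra_simps)
    from lower[OF this] show ?thesis
      using \<open>c > 0\<close> by (simp add: pos_divide_le_eq mult.commute)
  qed
  moreover have "q x \<le> p x" "q x \<le> p (x + v) - p v" for x
    using upper[of 0 x] upper[of 1 x] by auto
  ultimately show ?thesis
    by (rule that)
qed

text \<open>Hahn--Banach without extending functionals from subspaces: a minimal sublinear functional
  is linear, because \<open>sublinear_decrease\<close> cannot lower it any further.\<close>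

lemma Hahn_Banach_dominated:
  fixes p :: "'v::real_vector \<Rightarrow> real"
  assumes add: "\<And>x y. p (x + y) \<le> p x + p y"
    and scale: "\<And>c x. c > 0 \<Longrightarrow> p (c *\<^sub>R x) \<le> c * p x"
  obtains L where "linear L" "\<And>x. L x \<le> p x" "L v = p v"
proof -
  define S where "S q \<longleftrightarrow> (\<forall>x y. q (x + y) \<le> q x + q y) \<and>
      (\<forall>c x. c > 0 \<longrightarrow> q (c *\<^sub>R x) \<le> c * q x)" for q :: "'v \<Rightarrow> real"
  \<comment> \<open>Lowering \<open>p\<close> along \<open>v\<close> once, before Zorn's lemma,
    ensures \<open>p' (- v) \<le> - p v\<close>. Every linear functional below \<open>p'\<close>
    then takes the value \<open>p v\<close> at \<open>v\<close>.\<close>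
  obtain p' where p': "S p'" "\<And>x. p' x \<le> p x" "\<And>x. p' x \<le> p (x + v) - p v"
    using sublinear_decrease[OF assms, of v] unfolding S_def by metis
  \<comment> \<open>The order is reversed, so a maximal element in the sense of Zorn is a minimal
    sublinear functional.\<close>
  let ?A = "{q. S q \<and> (\<forall>x. q x \<le> p' x)}" and ?P = "\<lambda>q r :: 'v \<Rightarrow> real. r \<le> q"
  have zero: "q 0 = 0" if "S q" for q
    using that[unfolded S_def, THEN conjunct1, rule_format, of 0 0]
      that[unfolded S_def, THEN conjunct2, rule_format, of "1/2" 0] by simp
  \<comment> \<open>This common lower bound makes the pointwise infimum of a chain finite.\<close>
  have low: "- p' (- x) \<le> q x" if "q \<in> ?A" for q x
  proof -
    have "S q" using that by simp
    then have "q (x + (- x)) \<le> q x + q (- x)"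
      unfolding S_def by blast
    then show ?thesis
      using that zero[OF \<open>S q\<close>] by (smt (verit) add.right_inverse mem_Collect_eq)
  qed
  have "\<exists>m\<in>?A. \<forall>q\<in>?A. ?P m q \<longrightarrow> q = m"
  proof (rule predicate_Zorn)
    show "partial_order_on ?A (relation_of ?P ?A)"
      by (rule partial_order_on_relation_ofI) auto
  next
    fix \<C> assume \<C>: "\<C> \<in> Chains (relation_of ?P ?A)"
    then have sub: "\<C> \<subseteq> ?A" and tot: "\<And>q r. q \<in> \<C> \<Longrightarrow> r \<in> \<C> \<Longrightarrow> q \<le> r \<or> r \<le> q"
      unfolding Chains_def relation_of_def by auto
    show "\<exists>u\<in>?A. \<forall>q\<in>\<C>. ?P q u"
    proof (cases "\<C> = {}")
      case True
      then show ?thesis using p' by auto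
    next
      case False
      define u where "u x = (INF q\<in>\<C>. q x)" for x
      have bdd: "bdd_below ((\<lambda>q. q x) ` \<C>)" for x
        using low sub by (intro bdd_belowI2[of _ "- p' (- x)"]) blast
      have upper: "u x \<le> q x" if "q \<in> \<C>" for q x
        unfolding u_def by (rule cINF_lower[OF bdd that])
      have lower: "m \<le> u x" if "\<And>q. q \<in> \<C> \<Longrightarrow> m \<le> q x" for m x
        unfolding u_def by (rule cINF_greatest[OF False that])
      have "u (x + y) \<le> u x + u y" for x y
      proof -
        have "u (x + y) - u y \<le> q x" if q: "q \<in> \<C>" for q
        proof -
          have "u (x + y) - q x \<le> r y" if r: "r \<in> \<C>" for r
          proof -
            \<comment> \<open>In a chain the smaller of \<open>q\<close> and \<open>r\<close> can
              serve for both, so subadditivity of a single member suffices.\<close>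
            obtain s where s: "s \<in> \<C>" "s \<le> q" "s \<le> r"
              using tot[OF q r] q r by auto
            then have "s (x + y) \<le> s x + s y"
              using sub unfolding S_def by blast
            then show ?thesis
              using upper[OF s(1), of "x + y"] s(2,3) by (smt (verit) le_fun_def)
          qed
          then have "u (x + y) - q x \<le> u y"
            by (rule lower)
          then show ?thesis by simp
        qed
        then have "u (x + y) - u y \<le> u x"
          by (rule lower)
        then show ?thesis by simp
      qed
      moreover have "u (c *\<^sub>R x) \<le> c * u x" if "c > 0" for c x
      proof -
        have "u (c *\<^sub>R x) / c \<le> q x" if "q \<in> \<C>" for q
        proof -
          have "q (c *\<^sub>R x) \<le> c * q x"
            using sub that \<open>c > 0\<close> unfolding S_def by blast
          then show ?thesis
            using upper[OF that, of "c *\<^sub>R x"] \<open>c > 0\<close> by (simp add: pos_divide_le_eq mult.commute)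
        qed
        then have "u (c *\<^sub>R x) / c \<le> u x"
          by (rule lower)
        then show ?thesis
          using \<open>c > 0\<close> by (simp add: pos_divide_le_eq mult.commute)
      qed
      moreover have "u x \<le> p' x" for x
        using False sub upper by (force intro: order_trans)
      ultimately have "u \<in> ?A"
        unfolding S_def by simp
      then show ?thesis
        using upper by (auto simp: le_fun_def)
    qed
  qed
  then obtain m where m: "S m" "\<And>x. m x \<le> p' x"
    and min: "\<And>q. S q \<Longrightarrow> (\<And>x. q x \<le> p' x) \<Longrightarrow> q \<le> m \<Longrightarrow> q = m"
    by blast
  have sub: "m (x + y) \<le> m x + m y" and sc: "c > 0 \<Longrightarrow> m (c *\<^sub>R x) \<le> c * m x" for x y c
    using m(1) unfolding S_def by auto
  have m_add: "m (x + y) = m x + m y" for x y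
  proof -
    \<comment> \<open>Lowering \<open>m\<close> along \<open>y\<close> returns \<open>m\<close>
      itself by minimality, and the last property of \<open>q\<close> turns into
      superadditivity.\<close>
    obtain q where q: "S q" "\<And>x. q x \<le> m x" "\<And>x. q x \<le> m (x + y) - m y"
      using sublinear_decrease[OF sub sc, of y] unfolding S_def by metis
    then have "q = m"
      using m(2) by (intro min) (auto simp: le_fun_def intro: order_trans)
    then show ?thesis
      using q(3)[of x] sub[of x y] by simp
  qed
  have m_minus: "m (- x) = - m x" for x
    using m_add[of x "- x"] zero[OF m(1)] by simp
  have m_pos: "m (c *\<^sub>R x) = c * m x" if "c > 0" for c x
    using sc[OF that, of x] sc[OF that, of "- x"] by (simp add: m_minus)
  have "linear m"
  proof (rule linearI)
    fix c x
    show "m (c *\<^sub>R x) = c *\<^sub>R m x"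
      using m_pos[of c x] m_pos[of "- c" x] zero[OF m(1)]
      by (cases "c = 0"; cases "c > 0") (auto simp: m_minus)
  qed (rule m_add)
  moreover have "m x \<le> p x" for x
    using m(2)[of x] p'(2)[of x] by simp
  moreover have "m v = p v"
  proof -
    have "p 0 = 0"
      using add[of 0 0] scale[of "1/2" 0] by simp
    then have "m (- v) \<le> - p v"
      using m(2)[of "- v"] p'(3)[of "- v"] by simp
    then show ?thesis
      using calculation(2)[of v] by (simp add: m_minus)
  qed
  ultimately show ?thesis
    by (rule that)
qed

section \<open>Regular set functions\<close>

lemma compact_inner_regular_approx:
  assumes "compact_inner_regular S N" "finite_measure N" "A \<in> sets N" "\<epsilon> > 0"
  obtains K where "compactin S K" "K \<in> sets N" "K \<subseteq> A" "measure N (A - K) < \<epsilon>"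
proof -
  interpret finite_measure N by fact
  show ?thesis
  proof (cases "measure N A < \<epsilon>")
    \<comment> \<open>This case is separated because \<open>ennreal\<close> truncates a negative
      \<open>measure N A - \<epsilon>\<close> to 0; here the empty set is close enough.\<close>
    case True
    then show ?thesis
      by (intro that[of "{}"]) auto
  next
    case False
    have "ennreal (measure N A - \<epsilon>) < emeasure N A"
      using False \<open>\<epsilon> > 0\<close> by (simp add: emeasure_eq_measure ennreal_less_iff)
    also have "emeasure N A = (SUP K \<in> {K. compactin S K \<and> K \<in> sets N \<and> K \<subseteq> A}. emeasure N K)"
      using assms(1,3) unfolding compact_inner_regular_def by blast
    finally obtain K where K: "compactin S K" "K \<in> sets N" "K \<subseteq> A"
      and less: "ennreal (measure N A - \<epsilon>) < emeasure N K"
      unfolding less_SUP_iff by blast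
    have "measure N A - \<epsilon> < measure N K"
      using less False by (simp add: emeasure_eq_measure ennreal_less_iff)
    then have "measure N (A - K) < \<epsilon>"
      using K assms(3) by (simp add: finite_measure_Diff)
    then show ?thesis
      using K that by blast
  qed
qed

text \<open>Inner regularity is applied to \<open>A\<close> and to its complement. Compact sets are
  closed in a Hausdorff space, so the complement of the second compact set is an open superset of
  \<open>A\<close>.\<close>

lemma compact_inner_regular_sandwich:
  assumes "compact_inner_regular S N" "finite_measure N" "space N = topspace S"
    and "Hausdorff_space S" "A \<in> sets N" "\<epsilon> > 0"
  obtains K U where "closedin S K" "K \<in> sets N" "openin S U" "U \<in> sets N"
    "K \<subseteq> A" "A \<subseteq> U" "measure N (U - K) < \<epsilon>"
proof -
  interpret finite_measure N by fact
  obtain K where K: "compactin S K" "K \<in> sets N" "K \<subseteq> A" "measure N (A - K) < \<epsilon> / 2"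
    using compact_inner_regular_approx[OF assms(1,2,5), of "\<epsilon> / 2"] \<open>\<epsilon> > 0\<close> by auto
  obtain K' where K': "compactin S K'" "K' \<in> sets N" "K' \<subseteq> space N - A"
    "measure N ((space N - A) - K') < \<epsilon> / 2"
    using compact_inner_regular_approx[OF assms(1,2), of "space N - A" "\<epsilon> / 2"] \<open>\<epsilon> > 0\<close> assms(5)
    by auto
  let ?U = "topspace S - K'"
  have A: "A \<subseteq> space N"
    using assms(5) by (rule sets.sets_into_space)
  have U: "?U \<in> sets N"
    using K'(2) assms(3) by (metis sets.compl_sets)
  have 1: "A - K \<in> sets N" "(space N - A) - K' \<in> sets N"
    using K K' assms(5) by auto
  have "measure N (?U - K) \<le> measure N ((A - K) \<union> ((space N - A) - K'))"
    using 1 assms(3) by (intro finite_measure_mono sets.Un) auto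
  also have "\<dots> \<le> measure N (A - K) + measure N ((space N - A) - K')"
    using 1 by (rule measure_Un_le)
  finally have small: "measure N (?U - K) < \<epsilon>"
    using K(4) K'(4) by simp
  have "openin S ?U"
    using compactin_imp_closedin[OF assms(4) K'(1)] by blast
  moreover have "A \<subseteq> ?U"
    using A K'(3) assms(3) by blast
  ultimately show ?thesis
    using compactin_imp_closedin[OF assms(4) K(1)] K(2,3) U small by (intro that)
qed

text \<open>Alexandroff's theorem: a finitely additive set function on a compact space is countably
  additive on the algebra of sets that it approximates by closed sets from inside and open sets
  from outside.\<close>

lemma regular_content_extension:
  fixes c :: "'b set \<Rightarrow> real"
  assumes S: "compact_space S"
    and add: "\<And>A B. A \<subseteq> topspace S \<Longrightarrow> B \<subseteq> topspace S \<Longrightarrow> A \<inter> B = {} \<Longrightarrow> c (A \<union> B) = c A + c B"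
    and nonneg: "\<And>A. A \<subseteq> topspace S \<Longrightarrow> 0 \<le> c A"
  defines "R \<equiv> {A. A \<subseteq> topspace S \<and>
    (\<forall>\<epsilon>>0. \<exists>K U. closedin S K \<and> openin S U \<and> K \<subseteq> A \<and> A \<subseteq> U \<and> c (U - K) < \<epsilon>)}"
  obtains \<mu> where "space \<mu> = topspace S" "R \<subseteq> sets \<mu>"
    "\<And>A. A \<in> R \<Longrightarrow> emeasure \<mu> A = ennreal (c A)"
proof -
  have c0: "c {} = 0"
    using add[of "{}" "{}"] by simp
  have mono: "c A \<le> c B" if "A \<subseteq> B" "B \<subseteq> topspace S" for A B
  proof -
    have "c (A \<union> (B - A)) = c A + c (B - A)"
      using that by (intro add) auto
    moreover have "A \<union> (B - A) = B"
      using that by auto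
    ultimately show ?thesis
      using nonneg[of "B - A"] that by auto
  qed
  have subadd: "c (A \<union> B) \<le> c A + c B" if "A \<subseteq> topspace S" "B \<subseteq> topspace S" for A B
  proof -
    have "c (A \<union> (B - A)) = c A + c (B - A)"
      using that by (intro add) auto
    then show ?thesis
      using mono[of "B - A" B] that by auto
  qed
  have R_sub: "A \<subseteq> topspace S" if "A \<in> R" for A
    using that unfolding R_def by blast
  have R_D: "\<exists>K U. closedin S K \<and> openin S U \<and> K \<subseteq> A \<and> A \<subseteq> U \<and> c (U - K) < \<epsilon>"
    if "A \<in> R" "\<epsilon> > 0" for A \<epsilon>
    using that unfolding R_def by blast
  \<comment> \<open>Complementation exchanges the roles of \<open>K\<close> and \<open>U\<close>
    without changing \<open>U - K\<close>; for unions the two gaps are halved and added.\<close>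
  interpret R: algebra "topspace S" R
    unfolding algebra_iff_Un
  proof (intro conjI ballI)
    show "R \<subseteq> Pow (topspace S)"
      using R_sub by blast
    show "{} \<in> R"
    proof -
      have "closedin S {} \<and> openin S {} \<and> {} \<subseteq> {} \<and> {} \<subseteq> {} \<and> c ({} - {}) < \<epsilon>" if "\<epsilon> > 0" for \<epsilon>
        using that c0 by simp
      then show ?thesis
        unfolding R_def by blast
    qed
  next
    fix A assume A: "A \<in> R"
    show "topspace S - A \<in> R"
      unfolding R_def
    proof (intro CollectI conjI allI impI)
      fix \<epsilon> :: real assume "\<epsilon> > 0"
      obtain K U where "closedin S K" "openin S U" "K \<subseteq> A" "A \<subseteq> U" "c (U - K) < \<epsilon>"
        using R_D[OF A \<open>\<epsilon> > 0\<close>] by metis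
      moreover have "(topspace S - K) - (topspace S - U) = U - K"
        using openin_subset[OF \<open>openin S U\<close>] by auto
      ultimately show "\<exists>K U. closedin S K \<and> openin S U \<and> K \<subseteq> topspace S - A \<and>
          topspace S - A \<subseteq> U \<and> c (U - K) < \<epsilon>"
        by (intro exI[of _ "topspace S - U"] exI[of _ "topspace S - K"]) auto
    qed simp
  next
    fix A B assume A: "A \<in> R" and B: "B \<in> R"
    show "A \<union> B \<in> R"
      unfolding R_def
    proof (intro CollectI conjI allI impI)
      fix \<epsilon> :: real assume "\<epsilon> > 0"
      then have "\<epsilon> / 2 > 0" by simp
      obtain K U where 1: "closedin S K" "openin S U" "K \<subseteq> A" "A \<subseteq> U" "c (U - K) < \<epsilon> / 2"
        using R_D[OF A \<open>\<epsilon> / 2 > 0\<close>] by metis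
      obtain K' U' where 2: "closedin S K'" "openin S U'" "K' \<subseteq> B" "B \<subseteq> U'" "c (U' - K') < \<epsilon> / 2"
        using R_D[OF B \<open>\<epsilon> / 2 > 0\<close>] by metis
      have sub: "U \<subseteq> topspace S" "U' \<subseteq> topspace S"
        using openin_subset[OF 1(2)] openin_subset[OF 2(2)] by auto
      have "c ((U \<union> U') - (K \<union> K')) \<le> c ((U - K) \<union> (U' - K'))"
        using sub by (intro mono) auto
      also have "\<dots> \<le> c (U - K) + c (U' - K')"
        using sub by (intro subadd) auto
      finally have "c ((U \<union> U') - (K \<union> K')) < \<epsilon>"
        using 1 2 by simp
      then show "\<exists>K U. closedin S K \<and> openin S U \<and> K \<subseteq> A \<union> B \<and> A \<union> B \<subseteq> U \<and> c (U - K) < \<epsilon>"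
        using 1 2 by (intro exI[of _ "K \<union> K'"] exI[of _ "U \<union> U'"]) auto
    qed (use A B R_sub in auto)
  qed
  have "\<exists>\<mu>. (\<forall>A\<in>R. \<mu> A = ennreal (c A)) \<and> measure_space (topspace S) (sigma_sets (topspace S) R) \<mu>"
  \<comment> \<open>For a finite content, countable additivity amounts to continuity along sequences
    decreasing to the empty set.\<close>
  proof (rule R.caratheodory_empty_continuous)
    show "positive R (\<lambda>A. ennreal (c A))"
      by (simp add: positive_def c0)
    show "additive R (\<lambda>A. ennreal (c A))"
      using R_sub by (auto simp: additive_def add nonneg ennreal_plus)
  next
    fix A :: "nat \<Rightarrow> 'b set"
    assume A: "range A \<subseteq> R" "decseq A" "(\<Inter>i. A i) = {}"
    have A_sub: "A n \<subseteq> topspace S" for n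
      using A(1) R_sub by blast
    have "(\<lambda>n. c (A n)) \<longlonglongrightarrow> 0"
    proof (rule LIMSEQ_I)
      fix \<epsilon> :: real assume "\<epsilon> > 0"
      have "\<exists>K. closedin S K \<and> K \<subseteq> A n \<and> c (A n - K) < \<epsilon> * (1/2) ^ Suc n" for n
      proof -
        have "A n \<in> R" "\<epsilon> * (1/2) ^ Suc n > 0"
          using A(1) \<open>\<epsilon> > 0\<close> by auto
        then obtain K U where *: "closedin S K" "openin S U" "K \<subseteq> A n" "A n \<subseteq> U"
          "c (U - K) < \<epsilon> * (1/2) ^ Suc n"
          using R_D by metis
        moreover have "c (A n - K) \<le> c (U - K)"
          using * openin_subset[OF *(2)] by (intro mono) auto
        ultimately show ?thesis
          by (intro exI[of _ K]) auto
      qed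
      then obtain K where K: "\<And>n. closedin S (K n)" "\<And>n. K n \<subseteq> A n"
        "\<And>n. c (A n - K n) < \<epsilon> * (1/2) ^ Suc n"
        by metis
      \<comment> \<open>The sets \<open>K n\<close> need not be nested. Their finite intersections
        are, and the errors \<open>\<epsilon> / 2 ^ Suc i\<close> accumulated on the way sum to less
        than \<open>\<epsilon>\<close>.\<close>
      define K' where "K' n = (\<Inter>i\<in>{..n}. K i)" for n
      have K'_Suc: "K' (Suc n) = K' n \<inter> K (Suc n)" for n
        unfolding K'_def by (auto simp: atMost_Suc)
      have "(\<Inter>n. K' n) \<subseteq> (\<Inter>n. A n)"
        using K(2) unfolding K'_def by fast
      then have "(\<Inter>n. K' n) = {}"
        using A(3) by simp
      moreover have "closedin S (K' n)" for n
        unfolding K'_def using K(1) by (intro closedin_Inter) auto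
      moreover have "decseq K'"
        by (rule decseq_SucI) (simp add: K'_Suc)
      \<comment> \<open>By compactness, nested closed sets with empty intersection are empty from
        some index on, and there the error bound controls all of \<open>A N\<close>.\<close>
      ultimately obtain N where N: "K' N = {}"
        using compact_space_imp_nest[OF S, of K'] by metis
      \<comment> \<open>The right-hand side is the partial sum of the geometric error series,
        strictly below \<open>\<epsilon>\<close> for every \<open>n\<close>.\<close>
      have "c (A n - K' n) \<le> \<epsilon> * (1 - (1/2) ^ Suc n)" for n
      proof (induction n)
        case 0
        show ?case
          using K(3)[of 0] unfolding K'_def by simp
      next
        case (Suc n)
        have "c (A (Suc n) - K' (Suc n)) \<le> c ((A n - K' n) \<union> (A (Suc n) - K (Suc n)))"
          using A_sub decseqD[OF A(2), of n "Suc n"] by (intro mono) (auto simp: K'_Suc)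
        also have "\<dots> \<le> c (A n - K' n) + c (A (Suc n) - K (Suc n))"
          using A_sub by (intro subadd) auto
        also have "\<dots> \<le> \<epsilon> * (1 - (1/2) ^ Suc n) + \<epsilon> * (1/2) ^ Suc (Suc n)"
          using Suc.IH K(3)[of "Suc n"] by linarith
        also have "\<dots> = \<epsilon> * (1 - (1/2) ^ Suc (Suc n))"
          by (simp add: algebra_simps)
        finally show ?case .
      qed
      moreover have "\<epsilon> * (1 - (1/2) ^ Suc N) < \<epsilon>"
        using \<open>\<epsilon> > 0\<close> by simp
      ultimately have "c (A N) < \<epsilon>"
        using N by (metis Diff_empty le_less_trans)
      then have "norm (c (A n) - 0) < \<epsilon>" if "n \<ge> N" for n
        using mono[OF decseqD[OF A(2) that] A_sub] nonneg[OF A_sub[of n]] by simp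
      then show "\<exists>no. \<forall>n\<ge>no. norm (c (A n) - 0) < \<epsilon>"
        by blast
    qed
    then have "(\<lambda>n. ennreal (c (A n))) \<longlonglongrightarrow> ennreal 0"
      by (rule tendsto_ennrealI)
    then show "(\<lambda>n. ennreal (c (A n))) \<longlonglongrightarrow> 0"
      by simp
  qed simp
  then obtain m where m: "\<And>A. A \<in> R \<Longrightarrow> m A = ennreal (c A)"
    "measure_space (topspace S) (sigma_sets (topspace S) R) m"
    by blast
  have sub: "R \<subseteq> Pow (topspace S)"
    using R_sub by blast
  show ?thesis
  proof (rule that[of "measure_of (topspace S) R m"])
    show "space (measure_of (topspace S) R m) = topspace S"
      by (simp add: sub space_measure_of)
    show "R \<subseteq> sets (measure_of (topspace S) R m)"
      by (auto simp: sub sets_measure_of)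
    fix A assume "A \<in> R"
    then have "emeasure (measure_of (topspace S) R m) A = m A"
      using m(2) sub unfolding measure_space_def
      by (intro emeasure_measure_of[OF refl]) (auto simp: sets_measure_of)
    then show "emeasure (measure_of (topspace S) R m) A = ennreal (c A)"
      using m(1) \<open>A \<in> R\<close> by simp
  qed
qed

section \<open>Continuous functions on products of compact spaces\<close>

text \<open>On a compact Hausdorff space these are the nonnegative lower semicontinuous functions.
  The pointwise form directly supplies a continuous minorant that is almost optimal at a given
  point.\<close>

definition sup_of_continuous :: "'b topology \<Rightarrow> ('b \<Rightarrow> real) \<Rightarrow> bool" where
  "sup_of_continuous S f \<longleftrightarrow>
     (\<forall>x\<in>topspace S. \<forall>a<f x. \<exists>h. continuous_map S euclideanreal h \<and>
        (\<forall>y\<in>topspace S. 0 \<le> h y \<and> h y \<le> f y) \<and> a < h x)"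

lemma sup_of_continuousE:
  assumes "sup_of_continuous S f" "x \<in> topspace S" "a < f x"
  obtains h where "continuous_map S euclideanreal h"
    "\<And>y. y \<in> topspace S \<Longrightarrow> 0 \<le> h y" "\<And>y. y \<in> topspace S \<Longrightarrow> h y \<le> f y" "a < h x"
  using assms unfolding sup_of_continuous_def by metis

lemma sup_of_continuous_const: "c \<ge> 0 \<Longrightarrow> sup_of_continuous S (\<lambda>_. c)"
  unfolding sup_of_continuous_def by (auto intro!: exI[of _ "\<lambda>_. c"])

lemma sup_of_continuous_add:
  assumes f: "sup_of_continuous S f" and g: "sup_of_continuous S g"
  shows "sup_of_continuous S (\<lambda>x. f x + g x)"
  unfolding sup_of_continuous_def
proof (intro ballI allI impI)
  fix x a assume x: "x \<in> topspace S" and a: "a < f x + g x"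
  \<comment> \<open>The slack is divided evenly between the two summands.\<close>
  define d where "d = (f x + g x - a) / 2"
  have "f x - d < f x" "g x - d < g x"
    using a unfolding d_def by auto
  obtain h where h: "continuous_map S euclideanreal h"
    "\<And>y. y \<in> topspace S \<Longrightarrow> 0 \<le> h y" "\<And>y. y \<in> topspace S \<Longrightarrow> h y \<le> f y" "f x - d < h x"
    using sup_of_continuousE[OF f x \<open>f x - d < f x\<close>] by metis
  obtain k where k: "continuous_map S euclideanreal k"
    "\<And>y. y \<in> topspace S \<Longrightarrow> 0 \<le> k y" "\<And>y. y \<in> topspace S \<Longrightarrow> k y \<le> g y" "g x - d < k x"
    using sup_of_continuousE[OF g x \<open>g x - d < g x\<close>] by metis
  have "a = (f x - d) + (g x - d)"
    unfolding d_def by (simp add: field_simps)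
  then have "a < h x + k x"
    using h(4) k(4) by linarith
  then show "\<exists>h. continuous_map S euclideanreal h \<and>
        (\<forall>y\<in>topspace S. 0 \<le> h y \<and> h y \<le> f y + g y) \<and> a < h x"
    using h k by (intro exI[of _ "\<lambda>x. h x + k x"]) (auto intro: continuous_map_add add_mono)
qed

lemma sup_of_continuous_scale:
  assumes f: "sup_of_continuous S f" and c: "c > 0"
  shows "sup_of_continuous S (\<lambda>x. c * f x)"
  unfolding sup_of_continuous_def
proof (intro ballI allI impI)
  fix x a assume x: "x \<in> topspace S" and a: "a < c * f x"
  then have "a / c < f x"
    using c by (simp add: field_simps)
  then obtain h where h: "continuous_map S euclideanreal h"
    "\<And>y. y \<in> topspace S \<Longrightarrow> 0 \<le> h y" "\<And>y. y \<in> topspace S \<Longrightarrow> h y \<le> f y" "a / c < h x"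
    using sup_of_continuousE[OF f x] by metis
  then show "\<exists>h. continuous_map S euclideanreal h \<and>
        (\<forall>y\<in>topspace S. 0 \<le> h y \<and> h y \<le> c * f y) \<and> a < h x"
    using c by (intro exI[of _ "\<lambda>x. c * h x"]) (auto intro: continuous_map_real_mult_left simp: field_simps)
qed

text \<open>A compact Hausdorff space is normal, hence completely regular, so a continuous function
  separates \<open>x\<close> from the complement of \<open>U\<close>.\<close>

lemma sup_of_continuous_indicator:
  assumes S: "compact_space S" "Hausdorff_space S" and U: "openin S U"
  shows "sup_of_continuous S (indicator U)"
  unfolding sup_of_continuous_def
proof (intro ballI allI impI)
  fix x a assume "x \<in> topspace S" and a: "a < (indicator U x :: real)"
  show "\<exists>h. continuous_map S euclideanreal h \<and>
        (\<forall>y\<in>topspace S. 0 \<le> h y \<and> h y \<le> indicator U y) \<and> a < h x"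
  proof (cases "x \<in> U")
    case True
    have "completely_regular_space S"
      using S compact_Hausdorff_or_regular_imp_normal_space Hausdorff_imp_t1_space
        normal_imp_completely_regular_space_A by blast
    then obtain f where f: "continuous_map S euclideanreal f" "f x = 0" "f ` (topspace S - U) \<subseteq> {1}"
      unfolding completely_regular_space_alt' using U True by metis
    then show ?thesis
      using a True
      \<comment> \<open>This function is 1 at \<open>x\<close> and 0 off \<open>U\<close>; the
        absolute value and the maximum clip it to the unit interval.\<close>
      by (intro exI[of _ "\<lambda>y. max 0 (1 - \<bar>f y\<bar>)"])
        (auto intro!: continuous_intros simp: indicator_def)
  next
    case False
    then show ?thesis
      using a by (intro exI[of _ "\<lambda>_. 0"]) auto
  qed
qed

text \<open>The maximum of 0 and the finitely many \<open>h j\<close> is continuous and stays below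
  \<open>f\<close>.\<close>

lemma continuous_finite_upper_bound:
  assumes "finite J"
    and "\<And>j. j \<in> J \<Longrightarrow> continuous_map S euclideanreal (h j)"
    and "\<And>j y. j \<in> J \<Longrightarrow> y \<in> topspace S \<Longrightarrow> h j y \<le> f y"
    and "\<And>y. y \<in> topspace S \<Longrightarrow> 0 \<le> f y"
  obtains g where "continuous_map S euclideanreal g"
    "\<And>y. y \<in> topspace S \<Longrightarrow> 0 \<le> g y" "\<And>y. y \<in> topspace S \<Longrightarrow> g y \<le> (f y :: real)"
    "\<And>j y. j \<in> J \<Longrightarrow> y \<in> topspace S \<Longrightarrow> h j y \<le> g y"
proof -
  have "\<exists>g. continuous_map S euclideanreal g \<and> (\<forall>y\<in>topspace S. 0 \<le> g y \<and> g y \<le> f y) \<and>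
    (\<forall>j\<in>J. \<forall>y\<in>topspace S. h j y \<le> g y)"
    using assms
  proof (induction J rule: finite_induct)
    case empty
    then show ?case by (intro exI[of _ "\<lambda>_. 0"]) auto
  next
    case (insert i J)
    then obtain g where "continuous_map S euclideanreal g"
      "\<forall>y\<in>topspace S. 0 \<le> g y \<and> g y \<le> f y" "\<forall>j\<in>J. \<forall>y\<in>topspace S. h j y \<le> g y"
      by (metis insert_iff)
    then show ?case
      using insert.prems
      by (intro exI[of _ "\<lambda>y. max (g y) (h i y)"]) (auto intro: continuous_map_real_max simp: le_max_iff_disj)
  qed
  then show ?thesis
    using that by blast
qed

text \<open>A Dini-type argument: by compactness, finitely many choices of continuous minorants suffice.\<close>

lemma continuous_cover_of_sup_of_continuous:
  assumes P: "compact_space P" and M: "finite M"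
    and \<rho>: "\<And>C. C \<in> M \<Longrightarrow> continuous_map P (S C) (\<rho> C)"
    and f: "\<And>C. C \<in> M \<Longrightarrow> sup_of_continuous (S C) (f C)"
    and f0: "\<And>C y. C \<in> M \<Longrightarrow> y \<in> topspace (S C) \<Longrightarrow> 0 \<le> f C y"
    and gt: "\<And>\<omega>. \<omega> \<in> topspace P \<Longrightarrow> b < (\<Sum>C\<in>M. f C (\<rho> C \<omega>))"
  obtains h where "\<And>C. C \<in> M \<Longrightarrow> continuous_map (S C) euclideanreal (h C)"
    "\<And>C y. C \<in> M \<Longrightarrow> y \<in> topspace (S C) \<Longrightarrow> 0 \<le> h C y"
    "\<And>C y. C \<in> M \<Longrightarrow> y \<in> topspace (S C) \<Longrightarrow> h C y \<le> f C y"
    "\<And>\<omega>. \<omega> \<in> topspace P \<Longrightarrow> b \<le> (\<Sum>C\<in>M. h C (\<rho> C \<omega>))"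
proof -
  have \<rho>_in: "\<rho> C \<omega> \<in> topspace (S C)" if "C \<in> M" "\<omega> \<in> topspace P" for C \<omega>
    using continuous_map_image_subset_topspace[OF \<rho>[OF that(1)]] that(2) by blast
  have "\<exists>k. (\<forall>C\<in>M. continuous_map (S C) euclideanreal (k C) \<and>
      (\<forall>y\<in>topspace (S C). k C y \<le> f C y)) \<and> b < (\<Sum>C\<in>M. k C (\<rho> C \<omega>))"
    if \<omega>: "\<omega> \<in> topspace P" for \<omega>
  proof -
    define s where "s = (\<Sum>C\<in>M. f C (\<rho> C \<omega>)) - b"
    \<comment> \<open>Each context loses less than \<open>d\<close>; dividing by
      \<open>card M + 1\<close> keeps the total loss strictly below the slack \<open>s\<close>, also
      for empty \<open>M\<close>.\<close>
    define d where "d = s / (card M + 1)"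
    have "s > 0"
      using gt[OF \<omega>] unfolding s_def by simp
    then have "d > 0"
      unfolding d_def by (simp add: divide_pos_pos)
    have "\<exists>k. continuous_map (S C) euclideanreal k \<and> (\<forall>y\<in>topspace (S C). k y \<le> f C y) \<and>
        f C (\<rho> C \<omega>) - d < k (\<rho> C \<omega>)" if "C \<in> M" for C
      using sup_of_continuousE[OF f[OF that] \<rho>_in[OF that \<omega>], of "f C (\<rho> C \<omega>) - d"] \<open>d > 0\<close>
      by (metis diff_less_eq less_add_same_cancel1)
    then obtain k where k: "\<And>C. C \<in> M \<Longrightarrow> continuous_map (S C) euclideanreal (k C)"
      "\<And>C y. C \<in> M \<Longrightarrow> y \<in> topspace (S C) \<Longrightarrow> k C y \<le> f C y"
      "\<And>C. C \<in> M \<Longrightarrow> f C (\<rho> C \<omega>) - d < k C (\<rho> C \<omega>)"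
      by metis
    have "(real (card M) + 1) * d = s"
      unfolding d_def by (simp add: add_pos_nonneg field_simps flip: of_nat_Suc)
    then have "real (card M) * d + d = s"
      by (simp add: algebra_simps)
    then have "b < (\<Sum>C\<in>M. f C (\<rho> C \<omega>)) - real (card M) * d"
      using \<open>d > 0\<close> unfolding s_def by linarith
    also have "\<dots> = (\<Sum>C\<in>M. f C (\<rho> C \<omega>) - d)"
      by (simp add: sum_subtractf)
    also have "\<dots> \<le> (\<Sum>C\<in>M. k C (\<rho> C \<omega>))"
      using k(3) by (intro sum_mono) (simp add: less_imp_le)
    finally show ?thesis
      using k by blast
  qed
  then obtain k where k: "\<And>\<omega> C. \<omega> \<in> topspace P \<Longrightarrow> C \<in> M \<Longrightarrow> continuous_map (S C) euclideanreal (k \<omega> C)"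
    "\<And>\<omega> C y. \<omega> \<in> topspace P \<Longrightarrow> C \<in> M \<Longrightarrow> y \<in> topspace (S C) \<Longrightarrow> k \<omega> C y \<le> f C y"
    "\<And>\<omega>. \<omega> \<in> topspace P \<Longrightarrow> b < (\<Sum>C\<in>M. k \<omega> C (\<rho> C \<omega>))"
    by metis
  \<comment> \<open>The minorants chosen at \<open>\<omega>\<close> still sum to more than
    \<open>b\<close> on this open neighbourhood of \<open>\<omega>\<close>.\<close>
  define V where "V \<omega> = {\<omega>' \<in> topspace P. (\<Sum>C\<in>M. k \<omega> C (\<rho> C \<omega>')) \<in> {b<..}}" for \<omega>
  have "openin P (V \<omega>)" if "\<omega> \<in> topspace P" for \<omega>
    unfolding V_def
  proof (rule openin_continuous_map_preimage)
    show "continuous_map P euclideanreal (\<lambda>\<omega>'. \<Sum>C\<in>M. k \<omega> C (\<rho> C \<omega>'))"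
      using continuous_map_compose[OF \<rho> k(1)[OF that]]
      by (intro continuous_map_sum M) (auto simp: o_def)
  qed auto
  moreover have "topspace P \<subseteq> \<Union> (V ` topspace P)"
    unfolding V_def using k(3) by auto
  ultimately have "\<exists>\<F>. finite \<F> \<and> \<F> \<subseteq> V ` topspace P \<and> topspace P \<subseteq> \<Union>\<F>"
    using P unfolding compact_space_alt by (metis imageE)
  then obtain J where J: "finite J" "J \<subseteq> topspace P" "topspace P \<subseteq> \<Union> (V ` J)"
    by (metis finite_subset_image)
  have "\<exists>g. continuous_map (S C) euclideanreal g \<and> (\<forall>y\<in>topspace (S C). 0 \<le> g y \<and> g y \<le> f C y) \<and>
      (\<forall>j\<in>J. \<forall>y\<in>topspace (S C). k j C y \<le> g y)" if C: "C \<in> M" for C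
  proof -
    have J_in: "j \<in> topspace P" if "j \<in> J" for j
      using J(2) that by blast
    show ?thesis
      by (rule continuous_finite_upper_bound[OF J(1), of "S C" "\<lambda>j. k j C" "f C"])
        (use k(1,2)[OF J_in C] f0[OF C] in blast)+
  qed
  then obtain h where h: "\<And>C. C \<in> M \<Longrightarrow> continuous_map (S C) euclideanreal (h C)"
    "\<And>C y. C \<in> M \<Longrightarrow> y \<in> topspace (S C) \<Longrightarrow> 0 \<le> h C y \<and> h C y \<le> f C y"
    "\<And>C j y. C \<in> M \<Longrightarrow> j \<in> J \<Longrightarrow> y \<in> topspace (S C) \<Longrightarrow> k j C y \<le> h C y"
    by metis
  have "b \<le> (\<Sum>C\<in>M. h C (\<rho> C \<omega>))" if \<omega>: "\<omega> \<in> topspace P" for \<omega>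
  proof -
    obtain j where j: "j \<in> J" "\<omega> \<in> V j"
      using J(3) \<omega> by blast
    then have "b < (\<Sum>C\<in>M. k j C (\<rho> C \<omega>))"
      unfolding V_def by simp
    also have "\<dots> \<le> (\<Sum>C\<in>M. h C (\<rho> C \<omega>))"
      using h(3) j(1) \<rho>_in \<omega> by (intro sum_mono) auto
    finally show ?thesis by simp
  qed
  then show ?thesis
    using h by (intro that) auto
qed

section \<open>Borel sets on finite products of compact spaces\<close>

lemma space_borel_of [simp]: "space (borel_of S) = topspace S"
  and sets_borel_of: "sets (borel_of S) = sigma_sets (topspace S) {U. openin S U}"
proof -
  have "{U. openin S U} \<subseteq> Pow (topspace S)"
    using openin_subset by blast
  then show "space (borel_of S) = topspace S"
    "sets (borel_of S) = sigma_sets (topspace S) {U. openin S U}"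
    unfolding borel_of_def by (simp_all add: space_measure_of sets_measure_of)
qed

lemma openin_imp_borel_of: "openin S U \<Longrightarrow> U \<in> sets (borel_of S)"
  unfolding sets_borel_of by auto

lemma space_PiM_borel_of:
  "space (PiM I (\<lambda>i. borel_of (T i))) = topspace (product_topology T I)"
  by (simp add: space_PiM)

text \<open>Open boxes over a finite index set are measurable and form a base of the product
  topology; compactness selects a finite union of boxes inside \<open>G\<close> that covers
  \<open>K\<close>.\<close>

lemma PiM_separates_compact_open:
  assumes I: "finite I" and K: "compactin (product_topology T I) K"
    and G: "openin (product_topology T I) G" and "K \<subseteq> G"
  obtains W where "W \<in> sets (PiM I (\<lambda>i. borel_of (T i)))" "K \<subseteq> W" "W \<subseteq> G"
proof -
  have "\<exists>W. openin (product_topology T I) W \<and> W \<in> sets (PiM I (\<lambda>i. borel_of (T i))) \<and> x \<in> W \<and> W \<subseteq> G"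
    if x: "x \<in> G" for x
  proof -
    obtain V where V: "\<forall>i\<in>I. openin (T i) (V i)" "x \<in> Pi\<^sub>E I V" "Pi\<^sub>E I V \<subseteq> G"
      using bspec[OF G[unfolded openin_product_topology_alt] x] by blast
    have "openin (product_topology T I) (Pi\<^sub>E I V)"
      using I V(1) by (simp add: openin_PiE)
    moreover have "Pi\<^sub>E I V \<in> sets (PiM I (\<lambda>i. borel_of (T i)))"
      using I V(1) by (intro sets_PiM_I_finite openin_imp_borel_of) auto
    ultimately show ?thesis
      using V(2,3) by blast
  qed
  then obtain W where W: "\<And>x. x \<in> G \<Longrightarrow> openin (product_topology T I) (W x)"
    "\<And>x. x \<in> G \<Longrightarrow> W x \<in> sets (PiM I (\<lambda>i. borel_of (T i)))"
    "\<And>x. x \<in> G \<Longrightarrow> x \<in> W x" "\<And>x. x \<in> G \<Longrightarrow> W x \<subseteq> G"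
    by metis
  have "\<exists>\<F>. finite \<F> \<and> \<F> \<subseteq> W ` K \<and> K \<subseteq> \<Union>\<F>"
    using K W(1,3) \<open>K \<subseteq> G\<close> by (intro compactinD) auto
  then obtain J where J: "finite J" "J \<subseteq> K" "K \<subseteq> \<Union> (W ` J)"
    by (metis finite_subset_image)
  show ?thesis
  proof (rule that[of "\<Union> (W ` J)"])
    show "\<Union> (W ` J) \<in> sets (PiM I (\<lambda>i. borel_of (T i)))"
      using J W(2) \<open>K \<subseteq> G\<close> by (intro sets.finite_UN) auto
    show "\<Union> (W ` J) \<subseteq> G"
      using J W(4) \<open>K \<subseteq> G\<close> by blast
  qed (rule J(3))
qed

text \<open>The product \<open>\<sigma>\<close>-algebra may miss open sets of a non-metrizable product, but it contains
  the cozero sets, which are countable unions of compact sets.\<close>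

lemma borel_measurable_PiM_continuous:
  assumes I: "finite I" and P: "compact_space (product_topology T I)"
    and f: "continuous_map (product_topology T I) euclideanreal f"
  shows "f \<in> borel_measurable (PiM I (\<lambda>i. borel_of (T i)))"
proof (rule borel_measurableI_greater)
  fix a :: real
  let ?P = "product_topology T I"
  \<comment> \<open>These closed, hence compact, superlevel sets exhaust \<open>G\<close>.
    Measurable sets squeezed between each of them and \<open>G\<close> therefore have union
    \<open>G\<close>.\<close>
  define K where "K n = {x \<in> topspace ?P. f x \<in> {a + 1 / Suc n..}}" for n
  define G where "G = {x \<in> topspace ?P. f x \<in> {a<..}}"
  have "\<exists>W. W \<in> sets (PiM I (\<lambda>i. borel_of (T i))) \<and> K n \<subseteq> W \<and> W \<subseteq> G" for n
  proof -
    have "closedin ?P (K n)"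
      unfolding K_def by (rule closedin_continuous_map_preimage[OF f]) auto
    then have "compactin ?P (K n)"
      by (rule closedin_compact_space[OF P])
    moreover have "openin ?P G"
      unfolding G_def by (rule openin_continuous_map_preimage[OF f]) auto
    moreover have "K n \<subseteq> G"
      unfolding K_def G_def by (auto intro: less_le_trans[rotated])
    ultimately show ?thesis
      using PiM_separates_compact_open[OF I] by metis
  qed
  then obtain W where W: "\<And>n. W n \<in> sets (PiM I (\<lambda>i. borel_of (T i)))"
    "\<And>n. K n \<subseteq> W n" "\<And>n. W n \<subseteq> G"
    by metis
  have "G \<subseteq> (\<Union>n. K n)"
  proof
    fix x assume x: "x \<in> G"
    then obtain n where "1 / Suc n < f x - a"
      using nat_approx_posE[of "f x - a"] unfolding G_def by auto
    then show "x \<in> (\<Union>n. K n)"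
      using x unfolding G_def K_def by (auto intro!: exI[of _ n])
  qed
  moreover have "(\<Union>n. K n) \<subseteq> (\<Union>n. W n)"
    using W(2) by (rule UN_mono[OF subset_refl])
  moreover have "(\<Union>n. W n) \<subseteq> G"
    using W(3) by (rule UN_least)
  ultimately have "G = (\<Union>n. W n)"
    by (metis subset_antisym subset_trans)
  then show "{x \<in> space (PiM I (\<lambda>i. borel_of (T i))). a < f x} \<in> sets (PiM I (\<lambda>i. borel_of (T i)))"
    using W(1) unfolding G_def space_PiM_borel_of by (auto simp: sets.countable_UN)
qed

lemma continuous_map_restrict_product:
  assumes "J \<subseteq> I"
  shows "continuous_map (product_topology T I) (product_topology T J) (\<lambda>x. restrict x J)"
  unfolding continuous_map_componentwise
proof (intro conjI ballI)
  fix k assume "k \<in> J"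
  then have "continuous_map (product_topology T I) (T k) (\<lambda>x. x k)"
    using assms by (intro continuous_map_product_projection) auto
  then show "continuous_map (product_topology T I) (T k) (\<lambda>x. restrict x J k)"
    using \<open>k \<in> J\<close> by (auto elim: continuous_map_eq)
qed auto

lemma compact_space_product_topologyI:
  "(\<And>i. i \<in> I \<Longrightarrow> compact_space (T i)) \<Longrightarrow> compact_space (product_topology T I)"
  by (simp add: compact_space_product_topology)

lemma Hausdorff_space_product_topologyI:
  "(\<And>i. i \<in> I \<Longrightarrow> Hausdorff_space (T i)) \<Longrightarrow> Hausdorff_space (product_topology T I)"
  by (simp add: Hausdorff_space_product_topology)

lemma integrable_continuous_PiM:
  assumes I: "finite I" and P: "compact_space (product_topology T I)"
    and f: "continuous_map (product_topology T I) euclideanreal f"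
    and N: "finite_measure N" "sets N = sets (PiM I (\<lambda>i. borel_of (T i)))"
  shows "integrable N f"
proof -
  interpret finite_measure N by fact
  have "compactin euclideanreal (f ` topspace (product_topology T I))"
    using P f unfolding compact_space_def by (rule image_compactin)
  then have "bounded (f ` topspace (product_topology T I))"
    by (simp add: compact_imp_bounded)
  then obtain B where B: "\<And>x. x \<in> topspace (product_topology T I) \<Longrightarrow> norm (f x) \<le> B"
    unfolding bounded_iff by auto
  have "space N = topspace (product_topology T I)"
    using sets_eq_imp_space_eq[OF N(2)] space_PiM_borel_of by simp
  moreover have "f \<in> borel_measurable N"
    using borel_measurable_PiM_continuous[OF I P f] by (simp add: measurable_cong_sets[OF N(2) refl])
  ultimately show ?thesis
    using B by (intro integrable_const_bound[of _ B]) auto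
qed

section \<open>Duality\<close>

lemma finite_signed_measure_imp_measure:
  assumes \<nu>: "finite_signed_measure N \<nu>" and nonneg: "\<And>A. A \<in> sets N \<Longrightarrow> 0 \<le> \<nu> A"
  obtains \<mu> where "sets \<mu> = sets N" "\<And>A. A \<in> sets N \<Longrightarrow> emeasure \<mu> A = ennreal (\<nu> A)"
proof -
  define \<mu> where "\<mu> = measure_of (space N) (sets N) (\<lambda>A. ennreal (\<nu> A))"
  have sets: "sets \<mu> = sets N"
    unfolding \<mu>_def by simp
  have "countably_additive (sets N) (\<lambda>A. ennreal (\<nu> A))"
  proof (rule countably_additiveI)
    fix A :: "nat \<Rightarrow> _" assume A: "range A \<subseteq> sets N" "disjoint_family A"
    then have "(\<lambda>i. \<nu> (A i)) sums \<nu> (\<Union>i. A i)"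
      using \<nu> unfolding finite_signed_measure_def by blast
    then show "(\<Sum>i. ennreal (\<nu> (A i))) = ennreal (\<nu> (\<Union>i. A i))"
      using A nonneg by (intro suminf_ennreal_eq) auto
  qed
  moreover have "positive (sets N) (\<lambda>A. ennreal (\<nu> A))"
    using \<nu> by (simp add: positive_def finite_signed_measure_def)
  ultimately have "emeasure \<mu> A = ennreal (\<nu> A)" if "A \<in> sets N" for A
    using that unfolding \<mu>_def by (intro emeasure_measure_of_sigma sets.sigma_algebra_axioms)
  with sets show ?thesis
    by (rule that)
qed

lemma finite_signed_measure_measure:
  assumes "finite_measure \<mu>" "sets \<mu> = sets N"
  shows "finite_signed_measure N (measure \<mu>)"
  unfolding finite_signed_measure_def
  using finite_measure.finite_measure_UNION[OF assms(1)] assms(2) by auto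

lemma emeasure_marginal:
  assumes "sets \<mu> = sets (PiM V Out)" "U \<subseteq> V" "A \<in> sets (PiM U Out)"
  shows "emeasure (marginal Out U \<mu>) A = emeasure \<mu> ((\<lambda>\<omega>. restrict \<omega> U) -` A \<inter> space (PiM V Out))"
proof -
  have "(\<lambda>\<omega>. restrict \<omega> U) \<in> measurable \<mu> (PiM U Out)"
    using measurable_restrict_subset[OF assms(2), of Out] by (simp add: measurable_cong_sets[OF assms(1) refl])
  then show ?thesis
    using assms sets_eq_imp_space_eq[OF assms(1)] unfolding marginal_def by (simp add: emeasure_distr)
qed

section \<open>Compact scenarios and weak duality\<close>

locale compact_scenario =
  fixes X :: "'x set" and M :: "'x set set"
    and T :: "'x \<Rightarrow> 'a topology"
    and e :: "'x set \<Rightarrow> ('x \<Rightarrow> 'a) measure"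
  assumes finite_X: "finite X"
    and Union_M: "\<Union>M = X"
    and compact_T: "\<And>x. x \<in> X \<Longrightarrow> compact_space (T x)"
    and Hausdorff_T: "\<And>x. x \<in> X \<Longrightarrow> Hausdorff_space (T x)"
    and prob_e: "\<And>C. C \<in> M \<Longrightarrow> prob_space (e C)"
    and sets_e: "\<And>C. C \<in> M \<Longrightarrow> sets (e C) = sets (PiM C (\<lambda>x. borel_of (T x)))"
    and regular_e: "\<And>C. C \<in> M \<Longrightarrow> compact_inner_regular (product_topology T C) (e C)"
begin

abbreviation Out :: "'x \<Rightarrow> 'a measure" where
  "Out \<equiv> \<lambda>x. borel_of (T x)"

abbreviation P :: "'x set \<Rightarrow> ('x \<Rightarrow> 'a) topology" where
  "P \<equiv> product_topology T"

lemma finite_M: "finite M"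
  using finite_X Union_M by (metis finite_UnionD)

lemma subset_X: "C \<in> M \<Longrightarrow> C \<subseteq> X"
  using Union_M by blast

lemma finite_context: "C \<in> M \<Longrightarrow> finite C"
  using subset_X finite_X finite_subset by blast

lemma compact_P: "C \<subseteq> X \<Longrightarrow> compact_space (P C)"
  using compact_T by (intro compact_space_product_topologyI) auto

lemma Hausdorff_P: "C \<subseteq> X \<Longrightarrow> Hausdorff_space (P C)"
  using Hausdorff_T by (intro Hausdorff_space_product_topologyI) auto

lemma space_e: "C \<in> M \<Longrightarrow> space (e C) = topspace (P C)"
  using sets_eq_imp_space_eq[OF sets_e] space_PiM_borel_of by metis

lemma finite_measure_e: "C \<in> M \<Longrightarrow> finite_measure (e C)"
  using prob_e prob_space.finite_measure by blast

lemma integrable_e_continuous: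
  "C \<in> M \<Longrightarrow> continuous_map (P C) euclideanreal f \<Longrightarrow> integrable (e C) f"
  using integrable_continuous_PiM[OF finite_context compact_P] subset_X finite_measure_e sets_e
  by metis

lemma restrict_in_P: "C \<in> M \<Longrightarrow> \<omega> \<in> topspace (P X) \<Longrightarrow> restrict \<omega> C \<in> topspace (P C)"
  using subset_X by fastforce

text \<open>A nonnegative finite signed measure is an ordinary measure of the same mass, and its
  marginal constraints are those in \<open>NCF\<close>.\<close>

lemma primal_le_NCF: "primal_value Out X M e \<le> enn2ereal (NCF Out X M e)"
  unfolding primal_value_def
proof (rule SUP_least)
  fix \<nu> assume "\<nu> \<in> {\<nu>. primal_feasible Out X M e \<nu>}"
  then have \<nu>: "finite_signed_measure (PiM X Out) \<nu>"
    "\<And>C A. C \<in> M \<Longrightarrow> A \<in> sets (PiM C Out) \<Longrightarrow> signed_marginal Out X C \<nu> A \<le> measure (e C) A"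
    "\<And>A. A \<in> sets (PiM X Out) \<Longrightarrow> 0 \<le> \<nu> A"
    unfolding primal_feasible_def by auto
  obtain \<mu> where \<mu>: "sets \<mu> = sets (PiM X Out)"
    "\<And>A. A \<in> sets (PiM X Out) \<Longrightarrow> emeasure \<mu> A = ennreal (\<nu> A)"
    using finite_signed_measure_imp_measure[OF \<nu>(1,3)] by metis
  have "emeasure (marginal Out C \<mu>) A \<le> emeasure (e C) A"
    if C: "C \<in> M" and A: "A \<in> sets (PiM C Out)" for C A
  proof -
    interpret finite_measure "e C"
      using finite_measure_e[OF C] .
    have "(\<lambda>\<omega>. restrict \<omega> C) -` A \<inter> space (PiM X Out) \<in> sets (PiM X Out)"
      using measurable_restrict_subset[OF subset_X[OF C]] A by (rule measurable_sets)
    then have "emeasure (marginal Out C \<mu>) A = ennreal (signed_marginal Out X C \<nu> A)"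
      using emeasure_marginal[OF \<mu>(1) subset_X[OF C] A] \<mu>(2) by (simp add: signed_marginal_def)
    also have "\<dots> \<le> ennreal (measure (e C) A)"
      using \<nu>(2)[OF C A] by (rule ennreal_leI)
    finally show ?thesis
      by (simp add: emeasure_eq_measure)
  qed
  then have "emeasure \<mu> (space \<mu>) \<le> NCF Out X M e"
    unfolding NCF_def using \<mu>(1) by (intro SUP_upper) auto
  then have "ennreal (\<nu> (space (PiM X Out))) \<le> NCF Out X M e"
    using \<mu> sets_eq_imp_space_eq[OF \<mu>(1)] by simp
  then show "ereal (\<nu> (space (PiM X Out))) \<le> enn2ereal (NCF Out X M e)"
    using \<nu>(3) by (metis enn2ereal_ennreal less_eq_ennreal.rep_eq sets.top)
qed

text \<open>Integrating \<open>1 \<le> (\<Sum>C\<in>M. f C (restrict \<omega> C))\<close> against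
  \<open>\<mu>\<close> bounds its mass by integrals of \<open>f C\<close> against the marginals,
  which are dominated by \<open>e C\<close>.\<close>

lemma NCF_le_dual: "enn2ereal (NCF Out X M e) \<le> dual_value T X M e"
  unfolding dual_value_def
proof (rule INF_greatest)
  fix f assume "f \<in> {f. dual_feasible T X M f}"
  then have f: "\<And>C. C \<in> M \<Longrightarrow> continuous_map (P C) euclideanreal (f C)"
    "\<And>\<omega>. \<omega> \<in> topspace (P X) \<Longrightarrow> 1 \<le> (\<Sum>C\<in>M. f C (restrict \<omega> C))"
    "\<And>C \<omega>. C \<in> M \<Longrightarrow> \<omega> \<in> topspace (P C) \<Longrightarrow> 0 \<le> f C \<omega>"
    unfolding dual_feasible_def by auto
  have integral_nonneg: "0 \<le> (\<integral>\<omega>. f C \<omega> \<partial>e C)" if "C \<in> M" for C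
    using f(3)[OF that] space_e[OF that] by (intro integral_nonneg_AE AE_I2) simp
  then have s0: "0 \<le> (\<Sum>C\<in>M. \<integral>\<omega>. f C \<omega> \<partial>e C)"
    by (rule sum_nonneg)
  have "NCF Out X M e \<le> ennreal (\<Sum>C\<in>M. \<integral>\<omega>. f C \<omega> \<partial>e C)"
    unfolding NCF_def
  proof (rule SUP_least, clarify)
    fix \<mu> assume \<mu>: "sets \<mu> = sets (PiM X Out)"
      and le: "\<forall>C\<in>M. \<forall>A\<in>sets (PiM C Out). emeasure (marginal Out C \<mu>) A \<le> emeasure (e C) A"
    have space_\<mu>: "space \<mu> = topspace (P X)"
      using sets_eq_imp_space_eq[OF \<mu>] space_PiM_borel_of by metis
    have restr: "(\<lambda>\<omega>. restrict \<omega> C) \<in> measurable \<mu> (PiM C Out)" if "C \<in> M" for C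
      using measurable_restrict_subset[OF subset_X[OF that], of Out]
      by (simp add: measurable_cong_sets[OF \<mu> refl])
    have meas: "f C \<in> borel_measurable (PiM C Out)" if "C \<in> M" for C
      using borel_measurable_PiM_continuous[OF finite_context compact_P f(1)] that subset_X by blast
    have term_le: "(\<integral>\<^sup>+\<omega>. ennreal (f C (restrict \<omega> C)) \<partial>\<mu>) \<le> ennreal (\<integral>\<omega>. f C \<omega> \<partial>e C)"
      if C: "C \<in> M" for C
    proof -
      have "sets (marginal Out C \<mu>) = sets (e C)"
        unfolding marginal_def using sets_e[OF C] by simp
      \<comment> \<open>The setwise bound is turned into the order on measures, for which the
        integral of a nonnegative function is monotone.\<close>
      moreover have "marginal Out C \<mu> \<le> e C"
        unfolding le_measure_iff
      proof (simp add: calculation sets_eq_imp_space_eq[OF calculation], rule le_funI)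
        fix A show "emeasure (marginal Out C \<mu>) A \<le> emeasure (e C) A"
        proof (cases "A \<in> sets (PiM C Out)")
          case True
          then show ?thesis using le C by blast
        next
          \<comment> \<open>Off the \<sigma>-algebra both sides have the default value 0.\<close>
          case False
          then show ?thesis
            using calculation sets_e[OF C] by (simp add: emeasure_notin_sets)
        qed
      qed
      ultimately have "(\<integral>\<^sup>+\<omega>. ennreal (f C \<omega>) \<partial>marginal Out C \<mu>) \<le> (\<integral>\<^sup>+\<omega>. ennreal (f C \<omega>) \<partial>e C)"
        by (rule nn_integral_mono_measure)
      also have "\<dots> = ennreal (\<integral>\<omega>. f C \<omega> \<partial>e C)"
        using f(3)[OF C] space_e[OF C] by (intro nn_integral_eq_integral integrable_e_continuous C f(1)) auto
      finally show ?thesis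
        using restr[OF C] meas[OF C] unfolding marginal_def by (simp add: nn_integral_distr)
    qed
    have "emeasure \<mu> (space \<mu>) = (\<integral>\<^sup>+\<omega>. 1 \<partial>\<mu>)"
      by simp
    also have "\<dots> \<le> (\<integral>\<^sup>+\<omega>. (\<Sum>C\<in>M. ennreal (f C (restrict \<omega> C))) \<partial>\<mu>)"
    proof (rule nn_integral_mono)
      fix \<omega> assume "\<omega> \<in> space \<mu>"
      then have \<omega>: "\<omega> \<in> topspace (P X)"
        using space_\<mu> by simp
      have "(\<Sum>C\<in>M. ennreal (f C (restrict \<omega> C))) = ennreal (\<Sum>C\<in>M. f C (restrict \<omega> C))"
        using f(3) restrict_in_P \<omega> by (intro sum_ennreal) auto
      then show "1 \<le> (\<Sum>C\<in>M. ennreal (f C (restrict \<omega> C)))"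
        using f(2)[OF \<omega>] by simp
    qed
    also have "\<dots> = (\<Sum>C\<in>M. \<integral>\<^sup>+\<omega>. ennreal (f C (restrict \<omega> C)) \<partial>\<mu>)"
      using measurable_compose[OF restr meas] by (intro nn_integral_sum) auto
    also have "\<dots> \<le> (\<Sum>C\<in>M. ennreal (\<integral>\<omega>. f C \<omega> \<partial>e C))"
      using term_le by (rule sum_mono)
    also have "\<dots> = ennreal (\<Sum>C\<in>M. \<integral>\<omega>. f C \<omega> \<partial>e C)"
      using integral_nonneg by (rule sum_ennreal)
    finally show "emeasure \<mu> (space \<mu>) \<le> ennreal (\<Sum>C\<in>M. \<integral>\<omega>. f C \<omega> \<partial>e C)" .
  qed
  then show "enn2ereal (NCF Out X M e) \<le> ereal (\<Sum>C\<in>M. \<integral>\<omega>. f C \<omega> \<partial>e C)"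
    unfolding less_eq_ennreal.rep_eq enn2ereal_ennreal[OF s0] .
qed

section \<open>The relaxed dual and its value as a sublinear functional\<close>

definition admissible :: "('x set \<Rightarrow> ('x \<Rightarrow> 'a) \<Rightarrow> real) \<Rightarrow> bool" where
  "admissible f \<longleftrightarrow> (\<forall>C\<in>M. sup_of_continuous (P C) (f C) \<and> integrable (e C) (f C) \<and>
     (\<forall>y\<in>topspace (P C). 0 \<le> f C y))"

text \<open>Used for \<open>admissible\<close> families, whose integrability keeps each Bochner
  integral from falling back to its default value 0.\<close>

definition cost :: "('x set \<Rightarrow> ('x \<Rightarrow> 'a) \<Rightarrow> real) \<Rightarrow> real" where
  "cost f = (\<Sum>C\<in>M. \<integral>\<omega>. f C \<omega> \<partial>e C)"

text \<open>The covered function is a parameter, 1 in the dual program, so that the optimal cost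
  becomes a functional of \<open>g\<close>.\<close>

definition covers :: "('x set \<Rightarrow> ('x \<Rightarrow> 'a) \<Rightarrow> real) \<Rightarrow> (('x \<Rightarrow> 'a) \<Rightarrow> real) \<Rightarrow> bool" where
  "covers f g \<longleftrightarrow> (\<forall>\<omega>\<in>topspace (P X). g \<omega> \<le> (\<Sum>C\<in>M. f C (restrict \<omega> C)))"

lemma admissible_add: "admissible f \<Longrightarrow> admissible g \<Longrightarrow> admissible (\<lambda>C y. f C y + g C y)"
  unfolding admissible_def by (auto intro: sup_of_continuous_add)

lemma admissible_scale: "admissible f \<Longrightarrow> c > 0 \<Longrightarrow> admissible (\<lambda>C y. c * f C y)"
  unfolding admissible_def by (auto intro: sup_of_continuous_scale)

lemma admissible_const: "c \<ge> 0 \<Longrightarrow> admissible (\<lambda>_ _. c)"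
  unfolding admissible_def using finite_measure_e finite_measure.integrable_const
  by (auto intro: sup_of_continuous_const)

lemma cost_add: "admissible f \<Longrightarrow> admissible g \<Longrightarrow> cost (\<lambda>C y. f C y + g C y) = cost f + cost g"
  unfolding cost_def admissible_def by (simp flip: sum.distrib)

lemma cost_scale: "cost (\<lambda>C y. c * f C y) = c * cost f"
  unfolding cost_def by (simp add: sum_distrib_left)

lemma cost_const: "cost (\<lambda>_ _. c) = real (card M) * c"
  unfolding cost_def using prob_space.prob_space[OF prob_e] by simp

lemma cost_nonneg: "admissible f \<Longrightarrow> 0 \<le> cost f"
  unfolding cost_def admissible_def
  by (intro sum_nonneg integral_nonneg_AE AE_I2) (simp add: space_e)

text \<open>Raising every \<open>f C\<close> by \<open>\<epsilon> / card M\<close> makes the cover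
  strict, so continuous functions below the raised ones already cover 1. As each \<open>e C\<close>
  has mass 1, the cost rises by exactly \<open>\<epsilon>\<close>.\<close>

lemma dual_le_cost:
  assumes f: "admissible f" "covers f (\<lambda>_. 1)" and ne: "M \<noteq> {}"
  shows "dual_value T X M e \<le> ereal (cost f)"
proof (rule ereal_le_epsilon2)
  fix \<epsilon> :: real assume "\<epsilon> > 0"
  define d where "d = \<epsilon> / card M"
  have card: "card M > 0"
    using finite_M ne by (simp add: card_gt_0_iff)
  have "d > 0" "card M * d = \<epsilon>"
    using \<open>\<epsilon> > 0\<close> card unfolding d_def by auto
  define f' where "f' C y = f C y + d" for C y
  have f': "admissible f'"
    unfolding f'_def using admissible_add[OF f(1) admissible_const[of d]] \<open>d > 0\<close> by simp
  have gt: "1 < (\<Sum>C\<in>M. f' C (restrict \<omega> C))" if "\<omega> \<in> topspace (P X)" for \<omega>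
  proof -
    have "1 \<le> (\<Sum>C\<in>M. f C (restrict \<omega> C))"
      using f(2) that unfolding covers_def by blast
    moreover have "(\<Sum>C\<in>M. f' C (restrict \<omega> C)) = (\<Sum>C\<in>M. f C (restrict \<omega> C)) + \<epsilon>"
      unfolding f'_def using \<open>card M * d = \<epsilon>\<close> by (simp add: sum.distrib)
    ultimately show ?thesis
      using \<open>\<epsilon> > 0\<close> by linarith
  qed
  obtain h where h: "\<And>C. C \<in> M \<Longrightarrow> continuous_map (P C) euclideanreal (h C)"
    "\<And>C y. C \<in> M \<Longrightarrow> y \<in> topspace (P C) \<Longrightarrow> 0 \<le> h C y"
    "\<And>C y. C \<in> M \<Longrightarrow> y \<in> topspace (P C) \<Longrightarrow> h C y \<le> f' C y"
    "\<And>\<omega>. \<omega> \<in> topspace (P X) \<Longrightarrow> 1 \<le> (\<Sum>C\<in>M. h C (restrict \<omega> C))"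
  proof (rule continuous_cover_of_sup_of_continuous[where P = "P X" and M = M and S = P
        and \<rho> = "\<lambda>C \<omega>. restrict \<omega> C" and f = f' and b = 1])
    show "compact_space (P X)"
      using compact_P by blast
  qed (use f' finite_M gt continuous_map_restrict_product[OF subset_X] in \<open>auto simp: admissible_def\<close>)
  have "dual_feasible T X M h"
    unfolding dual_feasible_def using h by blast
  then have "dual_value T X M e \<le> ereal (cost h)"
    unfolding dual_value_def cost_def by (intro INF_lower) simp
  also have "cost h \<le> cost f'"
    unfolding cost_def
  proof (rule sum_mono)
    fix C assume C: "C \<in> M"
    show "(\<integral>\<omega>. h C \<omega> \<partial>e C) \<le> (\<integral>\<omega>. f' C \<omega> \<partial>e C)"
    proof (rule integral_mono)
      show "integrable (e C) (h C)"
        using C h(1)[OF C] by (rule integrable_e_continuous)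
      show "integrable (e C) (f' C)"
        using f' C unfolding admissible_def by blast
    qed (use h(3)[OF C] space_e[OF C] in simp)
  qed
  also have "cost f' = cost f + \<epsilon>"
    unfolding f'_def using cost_add[OF f(1) admissible_const[of d]] \<open>d > 0\<close> \<open>card M * d = \<epsilon>\<close>
    by (simp add: cost_const)
  finally show "dual_value T X M e \<le> ereal (cost f) + ereal \<epsilon>"
    by simp
qed

text \<open>Without contexts \<open>X\<close> is empty, the space of joint outcomes is a single
  point and no marginal constraint remains. Point masses of arbitrary weight make the primal value
  infinite.\<close>

lemma dual_le_primal_empty:
  assumes "M = {}"
  shows "dual_value T X M e \<le> primal_value Out X M e"
proof -
  have X: "X = {}"
    using assms Union_M by simp
  have "ereal r \<le> primal_value Out X M e" if "r \<ge> 0" for r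
  proof -
    \<comment> \<open>The constant \<open>undefined\<close> is the only extensional function on the
      empty set.\<close>
    define \<mu> where "\<mu> = scale_measure (ennreal r) (return (PiM X Out) (\<lambda>_. undefined))"
    have \<mu>: "emeasure \<mu> (space (PiM X Out)) = ennreal r" "sets \<mu> = sets (PiM X Out)"
      unfolding \<mu>_def
      by (simp_all add: emeasure_return[OF sets.top]) (simp add: X space_PiM)
    then have "finite_measure \<mu>"
      using sets_eq_imp_space_eq[OF \<mu>(2)] by (intro finite_measureI) simp
    then have "primal_feasible Out X M e (measure \<mu>)"
      using finite_signed_measure_measure \<mu>(2) assms unfolding primal_feasible_def by auto
    moreover have "measure \<mu> (space (PiM X Out)) = r"
      using \<mu>(1) that by (simp add: measure_def)
    ultimately show ?thesis
      unfolding primal_value_def by (metis (mono_tags, lifting) SUP_upper mem_Collect_eq)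
  qed
  then have "primal_value Out X M e = \<infinity>"
    by (metis ereal_top linear order_trans ereal_less_eq(3))
  then show ?thesis by simp
qed

text \<open>Bounded functions are encoded as continuous ones on the discrete copy of their domain, which
  makes them a real vector space.\<close>

definition majorant_cost :: "(('x \<Rightarrow> 'a) discrete \<Rightarrow>\<^sub>C real) \<Rightarrow> real" where
  "majorant_cost g = Inf (cost ` {f. admissible f \<and> covers f (\<lambda>\<omega>. g (discrete \<omega>))})"

lemma majorant_cost_le:
  fixes g :: "('x \<Rightarrow> 'a) discrete \<Rightarrow>\<^sub>C real"
  shows "admissible f \<Longrightarrow> covers f (\<lambda>\<omega>. g (discrete \<omega>)) \<Longrightarrow> majorant_cost g \<le> cost f"
  unfolding majorant_cost_def
  by (intro cINF_lower bdd_belowI2[of _ 0]) (auto intro: cost_nonneg)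

text \<open>A real infimum is meaningful only over a nonempty set. With at least one context, the
  constant family \<open>norm g\<close> covers \<open>g\<close>.\<close>

lemma le_majorant_cost:
  fixes g :: "('x \<Rightarrow> 'a) discrete \<Rightarrow>\<^sub>C real"
  assumes "M \<noteq> {}"
    and "\<And>f. admissible f \<Longrightarrow> covers f (\<lambda>\<omega>. g (discrete \<omega>)) \<Longrightarrow> b \<le> cost f"
  shows "b \<le> majorant_cost g"
  unfolding majorant_cost_def
proof (rule cINF_greatest)
  have "g (discrete \<omega>) \<le> (\<Sum>C\<in>M. norm g)" for \<omega>
  proof -
    have "g (discrete \<omega>) \<le> 1 * norm g"
      using norm_bounded[of g "discrete \<omega>"] by simp
    also have "\<dots> \<le> card M * norm g"
      using finite_M assms(1) by (intro mult_right_mono) (simp_all add: Suc_leI card_gt_0_iff)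
    finally show ?thesis by simp
  qed
  then have "covers (\<lambda>_ _. norm g) (\<lambda>\<omega>. g (discrete \<omega>))"
    unfolding covers_def by blast
  then show "{f. admissible f \<and> covers f (\<lambda>\<omega>. g (discrete \<omega>))} \<noteq> {}"
    using admissible_const[of "norm g"] by auto
qed (use assms(2) in auto)

lemma majorant_cost_add:
  assumes "M \<noteq> {}"
  shows "majorant_cost (g + h) \<le> majorant_cost g + majorant_cost h"
proof -
  have "majorant_cost (g + h) - majorant_cost h \<le> majorant_cost g"
  proof (rule le_majorant_cost[OF assms])
    fix f assume f: "admissible f" "covers f (\<lambda>\<omega>. g (discrete \<omega>))"
    have "majorant_cost (g + h) - cost f \<le> majorant_cost h"
    proof (rule le_majorant_cost[OF assms])
      fix k assume k: "admissible k" "covers k (\<lambda>\<omega>. h (discrete \<omega>))"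
      have "covers (\<lambda>C y. f C y + k C y) (\<lambda>\<omega>. (g + h) (discrete \<omega>))"
        using f(2) k(2) unfolding covers_def by (auto simp: sum.distrib intro: add_mono)
      then have "majorant_cost (g + h) \<le> cost (\<lambda>C y. f C y + k C y)"
        by (intro majorant_cost_le admissible_add f k)
      then show "majorant_cost (g + h) - cost f \<le> cost k"
        by (simp add: cost_add f k)
    qed
    then show "majorant_cost (g + h) - majorant_cost h \<le> cost f"
      by simp
  qed
  then show ?thesis by simp
qed

lemma majorant_cost_scale:
  assumes "M \<noteq> {}" "c > 0"
  shows "majorant_cost (c *\<^sub>R g) \<le> c * majorant_cost g"
proof -
  have "majorant_cost (c *\<^sub>R g) / c \<le> majorant_cost g"
  proof (rule le_majorant_cost[OF assms(1)])
    fix f assume f: "admissible f" "covers f (\<lambda>\<omega>. g (discrete \<omega>))"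
    have "covers (\<lambda>C y. c * f C y) (\<lambda>\<omega>. (c *\<^sub>R g) (discrete \<omega>))"
      using f(2) assms(2) unfolding covers_def by (simp flip: sum_distrib_left)
    then have "majorant_cost (c *\<^sub>R g) \<le> cost (\<lambda>C y. c * f C y)"
      by (intro majorant_cost_le admissible_scale f assms)
    then show "majorant_cost (c *\<^sub>R g) / c \<le> cost f"
      using assms(2) by (simp add: cost_scale pos_divide_le_eq mult.commute)
  qed
  then show ?thesis
    using assms(2) by (simp add: pos_divide_le_eq mult.commute)
qed

section \<open>Indicators and the content of cylinders\<close>

definition bounded_indicator :: "('x \<Rightarrow> 'a) set \<Rightarrow> (('x \<Rightarrow> 'a) discrete \<Rightarrow>\<^sub>C real)" where
  "bounded_indicator A = Bcontfun (\<lambda>\<omega>. indicator A (of_discrete \<omega>))"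

lemma apply_bounded_indicator: "bounded_indicator A \<omega> = indicator A (of_discrete \<omega>)"
proof -
  have "(\<lambda>\<omega>. indicator A (of_discrete \<omega>) :: real) \<in> bcontfun"
    by (rule bcontfun_normI[of _ 1]) (auto simp: continuous_on_open_vimage open_discrete indicator_def)
  then show ?thesis
    unfolding bounded_indicator_def by (simp add: Bcontfun_inverse)
qed

text \<open>On the joint outcomes this indicator is 1, so its covers are exactly the relaxed dual
  covers.\<close>

lemma dual_le_majorant_cost:
  assumes "M \<noteq> {}"
  shows "dual_value T X M e \<le> ereal (majorant_cost (bounded_indicator (topspace (P X))))"
proof -
  have le: "dual_value T X M e \<le> ereal (cost f)"
    if "admissible f" "covers f (\<lambda>\<omega>. bounded_indicator (topspace (P X)) (discrete \<omega>))" for f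
    using that unfolding covers_def
    by (intro dual_le_cost assms) (simp_all add: covers_def apply_bounded_indicator discrete_inverse)
  show ?thesis
  proof (cases "dual_value T X M e")
    case (real d)
    then show ?thesis
      using le by (auto intro!: le_majorant_cost assms)
  next
    case PInf
    have "\<And>f. admissible f \<Longrightarrow> \<not> covers f (\<lambda>\<omega>. bounded_indicator (topspace (P X)) (discrete \<omega>))"
      using le PInf by auto
    \<comment> \<open>With no admissible cover, every real number would vacuously be a lower bound,
      which is absurd.\<close>
    then have "majorant_cost (bounded_indicator (topspace (P X))) + 1 \<le> majorant_cost (bounded_indicator (topspace (P X)))"
      by (intro le_majorant_cost assms) auto
    then show ?thesis by simp
  qed simp
qed

text \<open>Outer regularity provides an open \<open>U\<close> containing \<open>A\<close> of nearly
  the same measure. Its indicator in context \<open>C\<close>, with 0 in all others, is an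
  admissible cover of cost \<open>measure (e C) U\<close>.\<close>

lemma majorant_cost_cylinder:
  assumes C: "C \<in> M" and A: "A \<in> sets (PiM C Out)"
  shows "majorant_cost (bounded_indicator {\<omega> \<in> topspace (P X). restrict \<omega> C \<in> A}) \<le> measure (e C) A"
proof (rule field_le_epsilon)
  interpret finite_measure "e C"
    using finite_measure_e[OF C] .
  fix \<epsilon> :: real assume "\<epsilon> > 0"
  have A': "A \<in> sets (e C)"
    using A sets_e[OF C] by simp
  obtain K U where KU: "K \<in> sets (e C)" "openin (P C) U" "U \<in> sets (e C)"
    "K \<subseteq> A" "A \<subseteq> U" "measure (e C) (U - K) < \<epsilon>"
    by (rule compact_inner_regular_sandwich[OF regular_e[OF C] finite_measure_e[OF C] space_e[OF C]
          Hausdorff_P[OF subset_X[OF C]] A' \<open>\<epsilon> > 0\<close>])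
  define f where "f C' y = (if C' = C then indicator U y else 0 :: real)" for C' y
  have "sup_of_continuous (P C) (indicator U)"
    using sup_of_continuous_indicator[OF compact_P Hausdorff_P KU(2)] subset_X[OF C] by blast
  moreover have "integrable (e C) (indicator U :: _ \<Rightarrow> real)"
    using KU(3) by (intro integrable_real_indicator) (simp_all add: emeasure_eq_measure)
  ultimately have "sup_of_continuous (P C') (f C') \<and> integrable (e C') (f C') \<and>
      (\<forall>y\<in>topspace (P C'). 0 \<le> f C' y)" for C'
    unfolding f_def by (cases "C' = C") (simp_all add: sup_of_continuous_const)
  then have "admissible f"
    unfolding admissible_def by blast
  moreover have "covers f (\<lambda>\<omega>. bounded_indicator {\<omega> \<in> topspace (P X). restrict \<omega> C \<in> A} (discrete \<omega>))"
    unfolding covers_def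
  proof
    fix \<omega> assume "\<omega> \<in> topspace (P X)"
    have "(\<Sum>C'\<in>M. f C' (restrict \<omega> C')) = indicator U (restrict \<omega> C)"
      unfolding f_def using finite_M C by (simp add: sum.delta if_distrib cong: if_cong)
    then show "bounded_indicator {\<omega> \<in> topspace (P X). restrict \<omega> C \<in> A} (discrete \<omega>)
        \<le> (\<Sum>C'\<in>M. f C' (restrict \<omega> C'))"
      using KU(5) by (auto simp: apply_bounded_indicator discrete_inverse indicator_def)
  qed
  ultimately have "majorant_cost (bounded_indicator {\<omega> \<in> topspace (P X). restrict \<omega> C \<in> A}) \<le> cost f"
    by (rule majorant_cost_le)
  also have "cost f = measure (e C) U"
  proof -
    have "(\<integral>y. f C' y \<partial>e C') = (if C' = C then measure (e C) U else 0)" for C'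
      unfolding f_def using KU(3) by auto
    then show ?thesis
      unfolding cost_def using finite_M C by simp
  qed
  also have "\<dots> \<le> measure (e C) (A \<union> (U - K))"
    using KU A' by (intro finite_measure_mono) auto
  also have "\<dots> \<le> measure (e C) A + measure (e C) (U - K)"
    using KU A' by (intro measure_Un_le) auto
  finally show "majorant_cost (bounded_indicator {\<omega> \<in> topspace (P X). restrict \<omega> C \<in> A}) \<le> measure (e C) A + \<epsilon>"
    using KU(6) by simp
qed

text \<open>Closed and open approximations of \<open>A\<close> pull back along the continuous
  projection. Their difference is the cylinder over \<open>U - K\<close>, on which \<open>c\<close>
  is dominated by \<open>e C\<close>.\<close>

lemma cylinder_regular:
  fixes c :: "('x \<Rightarrow> 'a) set \<Rightarrow> real"
  assumes C: "C \<in> M" and A: "A \<in> sets (PiM C Out)" and "\<epsilon> > 0"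
    and c: "\<And>B. B \<in> sets (PiM C Out) \<Longrightarrow> c {\<omega> \<in> topspace (P X). restrict \<omega> C \<in> B} \<le> measure (e C) B"
  shows "\<exists>K U. closedin (P X) K \<and> openin (P X) U \<and> K \<subseteq> {\<omega> \<in> topspace (P X). restrict \<omega> C \<in> A} \<and>
    {\<omega> \<in> topspace (P X). restrict \<omega> C \<in> A} \<subseteq> U \<and> c (U - K) < \<epsilon>"
proof -
  have A': "A \<in> sets (e C)"
    using A sets_e[OF C] by simp
  obtain K U where KU: "closedin (P C) K" "K \<in> sets (e C)" "openin (P C) U" "U \<in> sets (e C)"
    "K \<subseteq> A" "A \<subseteq> U" "measure (e C) (U - K) < \<epsilon>"
    by (rule compact_inner_regular_sandwich[OF regular_e[OF C] finite_measure_e[OF C] space_e[OF C]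
          Hausdorff_P[OF subset_X[OF C]] A' \<open>\<epsilon> > 0\<close>])
  let ?pre = "\<lambda>B. {\<omega> \<in> topspace (P X). restrict \<omega> C \<in> B}"
  have cont: "continuous_map (P X) (P C) (\<lambda>\<omega>. restrict \<omega> C)"
    using subset_X[OF C] by (rule continuous_map_restrict_product)
  have "U - K \<in> sets (PiM C Out)"
    using KU sets_e[OF C] by auto
  moreover have "?pre U - ?pre K = ?pre (U - K)"
    by blast
  ultimately have "c (?pre U - ?pre K) < \<epsilon>"
    using c[of "U - K"] KU(7) by simp
  moreover have "closedin (P X) (?pre K)"
    using cont KU(1) by (rule closedin_continuous_map_preimage)
  moreover have "openin (P X) (?pre U)"
    using cont KU(3) by (rule openin_continuous_map_preimage)
  moreover have "?pre K \<subseteq> ?pre A" "?pre A \<subseteq> ?pre U"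
    using KU(5,6) by auto
  ultimately show ?thesis
    by (intro exI[of _ "?pre K"] exI[of _ "?pre U"] conjI)
qed

section \<open>Strong duality\<close>

lemma dual_le_primal:
  "dual_value T X M e \<le> primal_value Out X M e"
proof (cases "M = {}")
  case True
  then show ?thesis by (rule dual_le_primal_empty)
next
  case ne: False
  obtain L where L: "linear L" "\<And>g. L g \<le> majorant_cost g"
    "L (bounded_indicator (topspace (P X))) = majorant_cost (bounded_indicator (topspace (P X)))"
    using Hahn_Banach_dominated[of majorant_cost "bounded_indicator (topspace (P X))", OF majorant_cost_add[OF ne]
        majorant_cost_scale[OF ne]] by metis
  define c where "c A = L (bounded_indicator A)" for A
  define cyl where "cyl C A = {\<omega> \<in> topspace (P X). restrict \<omega> C \<in> A}" for C A
  have add: "c (A \<union> B) = c A + c B" if "A \<inter> B = {}" for A B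
  proof -
    have "bounded_indicator (A \<union> B) = bounded_indicator A + bounded_indicator B"
      using that by (intro bcontfun_eqI) (auto simp: apply_bounded_indicator indicator_def)
    then show ?thesis
      unfolding c_def by (simp add: linear_add[OF L(1)])
  qed
  have nonneg: "0 \<le> c A" for A
  proof -
    \<comment> \<open>The zero family covers \<open>- bounded_indicator A\<close> at cost 0, so
      domination by \<open>majorant_cost\<close> yields positivity of \<open>L\<close>.\<close>
    have "covers (\<lambda>_ _. 0) (\<lambda>\<omega>. (- bounded_indicator A) (discrete \<omega>))"
      unfolding covers_def by (simp add: apply_bounded_indicator)
    then have "majorant_cost (- bounded_indicator A) \<le> cost (\<lambda>_ _. 0)"
      by (intro majorant_cost_le admissible_const) simp_all
    then have "L (- bounded_indicator A) \<le> 0"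
      using L(2)[of "- bounded_indicator A"] cost_const[of 0] by linarith
    then show ?thesis
      unfolding c_def by (simp add: linear_neg[OF L(1)])
  qed
  have cyl_le: "c (cyl C A) \<le> measure (e C) A" if "C \<in> M" "A \<in> sets (PiM C Out)" for C A
    using L(2) majorant_cost_cylinder[OF that] unfolding c_def cyl_def by (rule order_trans)
  obtain \<mu> where space_\<mu>: "space \<mu> = topspace (P X)"
    and \<mu>: "\<And>A. A \<subseteq> topspace (P X) \<Longrightarrow>
      (\<And>\<epsilon>. \<epsilon> > 0 \<Longrightarrow> \<exists>K U. closedin (P X) K \<and> openin (P X) U \<and> K \<subseteq> A \<and> A \<subseteq> U \<and> c (U - K) < \<epsilon>) \<Longrightarrow>
      A \<in> sets \<mu> \<and> emeasure \<mu> A = ennreal (c A)"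
  proof (rule regular_content_extension[OF compact_P[OF subset_refl], of c])
    fix \<mu> :: "('x \<Rightarrow> 'a) measure"
    let ?R = "{A. A \<subseteq> topspace (P X) \<and> (\<forall>\<epsilon>>0. \<exists>K U. closedin (P X) K \<and> openin (P X) U \<and>
      K \<subseteq> A \<and> A \<subseteq> U \<and> c (U - K) < \<epsilon>)}"
    assume *: "space \<mu> = topspace (P X)" "?R \<subseteq> sets \<mu>" "\<And>A. A \<in> ?R \<Longrightarrow> emeasure \<mu> A = ennreal (c A)"
    show thesis
    proof (rule that[OF *(1)])
      fix A assume "A \<subseteq> topspace (P X)"
        "\<And>\<epsilon>. \<epsilon> > 0 \<Longrightarrow> \<exists>K U. closedin (P X) K \<and> openin (P X) U \<and> K \<subseteq> A \<and> A \<subseteq> U \<and> c (U - K) < \<epsilon>"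
      then have "A \<in> ?R" by simp
      then show "A \<in> sets \<mu> \<and> emeasure \<mu> A = ennreal (c A)"
        using *(2,3) by blast
    qed
  qed (use add nonneg in auto)
  have cyl: "cyl C A \<in> sets \<mu> \<and> emeasure \<mu> (cyl C A) = ennreal (c (cyl C A))"
    if C: "C \<in> M" and A: "A \<in> sets (PiM C Out)" for C A
  proof (rule \<mu>)
    show "cyl C A \<subseteq> topspace (P X)"
      unfolding cyl_def by blast
    fix \<epsilon> :: real assume \<epsilon>: "\<epsilon> > 0"
    show "\<exists>K U. closedin (P X) K \<and> openin (P X) U \<and> K \<subseteq> cyl C A \<and> cyl C A \<subseteq> U \<and> c (U - K) < \<epsilon>"
      unfolding cyl_def
      by (rule cylinder_regular[OF C A \<epsilon>]) (rule cyl_le[OF C, unfolded cyl_def])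
  qed
  note cyl_sets = cyl[THEN conjunct1] and cyl_emeasure = cyl[THEN conjunct2]
  \<comment> \<open>A coordinate preimage is a cylinder over any context containing the label, and
    the contexts exhaust \<open>X\<close>.\<close>
  have meas: "(\<lambda>\<omega> i. \<omega> i) \<in> measurable \<mu> (PiM X Out)"
  proof (rule measurable_PiM_single')
    show "(\<lambda>\<omega> i. \<omega> i) \<in> space \<mu> \<rightarrow> (\<Pi>\<^sub>E i\<in>X. space (Out i))"
      unfolding space_\<mu> by simp
    fix x assume x: "x \<in> X"
    then obtain C where C: "C \<in> M" "x \<in> C"
      using Union_M by blast
    show "(\<lambda>\<omega>. \<omega> x) \<in> measurable \<mu> (Out x)"
    proof (rule measurableI)
      fix \<omega> assume "\<omega> \<in> space \<mu>"
      then show "\<omega> x \<in> space (Out x)"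
        using x unfolding space_\<mu> by auto
    next
      fix A assume A: "A \<in> sets (Out x)"
      have "(\<lambda>y. y x) -` A \<inter> space (PiM C Out) \<in> sets (PiM C Out)"
        using measurable_component_singleton[OF C(2)] A by (rule measurable_sets)
      then have "cyl C ((\<lambda>y. y x) -` A \<inter> space (PiM C Out)) \<in> sets \<mu>"
        by (rule cyl_sets[OF C(1)])
      moreover have "cyl C ((\<lambda>y. y x) -` A \<inter> space (PiM C Out)) = (\<lambda>\<omega>. \<omega> x) -` A \<inter> space \<mu>"
        using C restrict_in_P[OF C(1)] unfolding cyl_def space_\<mu> space_PiM_borel_of by auto
      ultimately show "(\<lambda>\<omega>. \<omega> x) -` A \<inter> space \<mu> \<in> sets \<mu>"
        by simp
    qed
  qed
  \<comment> \<open>Pushing forward along the identity restricts \<open>\<mu>\<close> to the product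
    \<sigma>-algebra, since that of \<open>\<mu>\<close> may be larger.\<close>
  define \<nu> where "\<nu> = distr \<mu> (PiM X Out) (\<lambda>\<omega>. \<omega>)"
  have \<nu>_cyl: "emeasure \<nu> ((\<lambda>\<omega>. restrict \<omega> C) -` A \<inter> space (PiM X Out)) = ennreal (c (cyl C A))"
    if "C \<in> M" "A \<in> sets (PiM C Out)" for C A
  proof -
    have "(\<lambda>\<omega>. restrict \<omega> C) -` A \<inter> space (PiM X Out) \<in> sets (PiM X Out)"
      using measurable_restrict_subset[OF subset_X[OF that(1)]] that(2) by (rule measurable_sets)
    moreover have "(\<lambda>\<omega>. restrict \<omega> C) -` A \<inter> space (PiM X Out) = cyl C A"
      unfolding cyl_def space_PiM_borel_of by auto
    ultimately show ?thesis
      unfolding \<nu>_def using meas cyl_emeasure[OF that] sets.sets_into_space[OF cyl_sets[OF that]]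
      by (simp add: emeasure_distr Int_absorb2)
  qed
  obtain C where C: "C \<in> M"
    using ne by blast
  \<comment> \<open>The whole space is the cylinder over the full outcome space of one context,
    which gives the total mass.\<close>
  have "(\<lambda>\<omega>. restrict \<omega> C) -` space (PiM C Out) \<inter> space (PiM X Out) = space (PiM X Out)"
    using restrict_in_P[OF C] unfolding space_PiM_borel_of by auto
  moreover have "cyl C (space (PiM C Out)) = topspace (P X)"
    using restrict_in_P[OF C] unfolding cyl_def space_PiM_borel_of by auto
  ultimately have total: "emeasure \<nu> (space (PiM X Out)) = ennreal (c (topspace (P X)))"
    using \<nu>_cyl[OF C sets.top] by simp
  have sets_\<nu>: "sets \<nu> = sets (PiM X Out)"
    unfolding \<nu>_def by simp
  have "finite_measure \<nu>"
    using total sets_eq_imp_space_eq[OF sets_\<nu>] by (intro finite_measureI) simp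
  then have "finite_signed_measure (PiM X Out) (measure \<nu>)"
    using sets_\<nu> by (rule finite_signed_measure_measure)
  moreover have "signed_marginal Out X C (measure \<nu>) A \<le> measure (e C) A"
    if "C \<in> M" "A \<in> sets (PiM C Out)" for C A
    using \<nu>_cyl[OF that] cyl_le[OF that] nonneg unfolding signed_marginal_def
    by (simp add: measure_def)
  ultimately have "primal_feasible Out X M e (measure \<nu>)"
    unfolding primal_feasible_def by simp
  then have "ereal (measure \<nu> (space (PiM X Out))) \<le> primal_value Out X M e"
    unfolding primal_value_def by (intro SUP_upper) simp
  moreover have "measure \<nu> (space (PiM X Out)) = majorant_cost (bounded_indicator (topspace (P X)))"
    using total nonneg[of "topspace (P X)"] L(3) unfolding c_def measure_def by (metis enn2real_ennreal)
  ultimately show ?thesis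
    using dual_le_majorant_cost[OF ne] by simp
qed

end

theorem proposition2:
  fixes X :: "'x set" and M :: "'x set set"
    and T :: "'x \<Rightarrow> 'a topology"
    and e :: "'x set \<Rightarrow> ('x \<Rightarrow> 'a) measure"
  defines "Out \<equiv> \<lambda>x. borel_of (T x)"
  assumes "finite X"
    and "measurement_scenario X M"
    and "\<And>x. x \<in> X \<Longrightarrow> compact_space (T x)"
    and "\<And>x. x \<in> X \<Longrightarrow> Hausdorff_space (T x)"
    and "empirical_model Out M e"
    and "\<And>C. C \<in> M \<Longrightarrow> compact_inner_regular (product_topology T C) (e C)"
  shows "primal_value Out X M e = dual_value T X M e \<and>
         dual_value T X M e = enn2ereal (NCF Out X M e)"
proof -
  interpret compact_scenario X M T e
  proof (rule compact_scenario.intro)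
    show "\<Union>M = X"
      using assms(3) by (simp add: measurement_scenario_def)
    show "prob_space (e C)" if "C \<in> M" for C
      using assms(6) that by (simp add: empirical_model_def)
    show "sets (e C) = sets (PiM C (\<lambda>x. borel_of (T x)))" if "C \<in> M" for C
      using assms(6) that by (simp add: empirical_model_def Out_def)
  qed (fact assms)+
  have "primal_value Out X M e \<le> enn2ereal (NCF Out X M e)"
    unfolding Out_def by (rule primal_le_NCF)
  moreover have "enn2ereal (NCF Out X M e) \<le> dual_value T X M e"
    unfolding Out_def by (rule NCF_le_dual)
  moreover have "dual_value T X M e \<le> primal_value Out X M e"
    unfolding Out_def by (rule dual_le_primal)
  ultimately show ?thesis
    by (intro conjI antisym) (auto intro: order_trans)
qed

end
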